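(* Let $J\subset\mathcal P=k[X_0,\dots,X_n]$ be a strongly stable monomial ideal, and let $\mathfrak A,\mathfrak R,\mathfrak R'\subset k[C]$ and $B\mathcal St(J)\subset\mathbb A^N$ (the subscheme defined by $\mathfrak A$) be as defined in the context. Then: 1) There is a one-to-one correspondence (sending a point $c\in k^N$ to the ideal generated by the specialization of $\mathcal G$ at $C=c$) between the closed points of $B\mathcal St(J)$ and the homogeneous ideals $I\subset\mathcal P$ such that $\mathcal N(J)$ is a basis of the $k$-vector space $\mathcal P/I$. One of the closed points of $B\mathcal St(J)$ is the origin, which corresponds to the ideal $J$ itself. 2) $B\mathcal St(J)$ is homogeneous (i.e. $\mathfrak A$ is a homogeneous ideal) with respect to the non-standard grading $\lambda$ of $k[C]$ over the group $\mathbb Z^{n+1}$ given by $\lambda(C_{\alpha\gamma})=\alpha-\gamma$. 3) $\mathfrak A=\mathfrak R=\mathfrak R'$; hence $B\mathcal St(J)$ can also be defined using the complete $\mathcal G^{**}$-reductions of $S$-polynomials of elements of $\mathcal G$.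
   Context: $k$ is an algebraically closed field of any characteristic, $\mathcal P=k[X_0,\dots,X_n]$ with the variables ordered $X_0<X_1<\dots<X_n$; $X^\alpha=X_0^{\alpha_0}\cdots X_n^{\alpha_n}$, $|\alpha|=\sum\alpha_i$. For a monomial ideal $J$, $B_J$ is its set of minimal monomial generators, $\mathcal N(J)$ is the set of monomials not in $J$; $J_m$, $\mathcal N(J)_m$ denote degree $m$ parts. Strongly stable: an up elementary move replaces a monomial $X^\delta X_i$ by $X^\delta X_j$ with $X_i<X_j$; write $X^\alpha\prec_B X^\beta$ if $X^\beta$ is obtained from $X^\alpha$ by a sequence of up elementary moves. $J$ is strongly stable if it contains every monomial $X^\alpha$ with $X^\alpha\succ_B X^\beta$ for some monomial $X^\beta\in J$. Let $C$ be the set of new variables $C_{\alpha\gamma}$, one for each $X^\alpha\in B_J$ and $X^\gamma\in\mathcal N(J)_{|\alpha|}$, and $N$ their number. Let $$\mathcal G=\Big\{F_\alpha=X^\alpha-\sum_{X^\gamma\in\mathcal N(J)_{|\alpha|}}C_{\alpha\gamma}X^\gamma\ \Big|\ X^\alpha\in B_J\Big\}\subset k[C][X].$$ The ideal $\mathfrak A$: for each $m$ let $A_m$ be the matrix whose columns correspond to the monomials of degree $m$ in the variables $X$ and whose rows contain the coefficients (in $k[C]$) of those monomials in each polynomial $X^\beta F_\alpha$ with $X^\alpha\in B_J$ and $|\beta+\alpha|=m$. $\mathfrak A\subset k[C]$ is the ideal generated by all minors of $A_m$ of order $\dim_k(J_m)+1$, for all $m\ge0$. The stratum $B\mathcal St(J)$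 is the subscheme of $\mathbb A^N$ (with coordinate ring $k[C]$) defined by $\mathfrak A$. $\mathcal G^{**}$-reduction: for each $m$ let $W_m=\{X^\delta F_\alpha\mid X^{\delta+\alpha}\in J_m,\ X^\alpha\in B_J\}$. The head of $X^\delta F_\alpha$ is $X^{\delta+\alpha}$ and its tail is $X^{\delta+\alpha}-X^\delta F_\alpha$. For $X^\delta F_\alpha,X^{\delta'}F_{\alpha'}\in W_m$ put $X^\delta F_\alpha>X^{\delta'}F_{\alpha'}$ iff the first non-zero entry of $\delta'-\delta$ (entries indexed $0,\dots,n$ in this order) is positive. For each monomial $X^\beta\in J_m$ the elements of $W_m$ with head $X^\beta$ form a finite totally ordered set; $V_m$ is the set of the minima obtained for the various $X^\beta\in J_m$. A step of $\mathcal G^{**}$-reduction of a polynomial $h\in k[C][X]$, homogeneous of degree $m$ in $X$, replaces a monomial $X^\beta\in J_m$ appearing in $h$ (keeping its coefficient in $k[C]$) by the tail of the unique element of $V_m$ with head $X^\beta$. The complete $\mathcal G^{**}$-reduction of $h$ is the polynomial obtained by finitely many such steps in which only monomials $X^\gamma\in\mathcal N(J)$ appear. The ideals $\mathfrak R,\mathfrak R'$: the $S$-polynomial of $F_\alpha,F_{\alpha'}$ is $S(F_\alpha,F_{\alpha'})=X^\delta F_\alpha-X^{\delta'}F_{\alpha'}$ with $X^{\delta+\alpha}=X^{\delta'+\alpha'}=\mathrm{LCM}(X^\alpha,X^{\alpha'})$. Let $H_{\alpha,\alpha'}$ be its complete $\mathcal G^{**}$-reduction. $\mathfrak R\subset k[C]$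 is the ideal generated by the coefficients in $k[C]$ of all the $H_{\alpha,\alpha'}$, regarded as polynomials in $X$. $\mathfrak R'$ is the ideal obtained in the same way using only those $S$-polynomials $X^\delta F_\alpha-X^{\delta'}F_{\alpha'}$ such that $X^\delta F_\alpha$ is minimal among the elements of $W_{|\delta+\alpha|}$ with head $X^{\delta+\alpha}$. *)

theory Defs
  imports
    "HOL-Library.Poly_Mapping"
    "HOL-Library.FuncSet"
    "HOL-Computational_Algebra.Polynomial"
    "HOL-Algebra.Ideal"
    "Jordan_Normal_Form.Determinant"
begin

text \<open>
  The ring \<open>P = k[X_0, ..., X_n]\<close> is the type \<open>('n, 'k) mpol\<close>, where the ordered set of variables
  \<open>X_0 < ... < X_n\<close> is an arbitrary type \<open>'n\<close> of class \<open>{finite, linorder}\<close>. A monomial is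
  identified with its exponent vector, so that the product of monomials is \<open>+\<close>.
\<close>

type_synonym 'v mon = "'v \<Rightarrow>\<^sub>0 nat"
type_synonym ('v, 'r) mpol = "'v mon \<Rightarrow>\<^sub>0 'r"

abbreviation lookup :: "('a \<Rightarrow>\<^sub>0 'b::zero) \<Rightarrow> 'a \<Rightarrow> 'b" where
  "lookup \<equiv> Poly_Mapping.lookup"

abbreviation keys :: "('a \<Rightarrow>\<^sub>0 'b::zero) \<Rightarrow> 'a set" where
  "keys \<equiv> Poly_Mapping.keys"

definition mdeg :: "'n::finite mon \<Rightarrow> nat" where
  "mdeg \<alpha> = (\<Sum>i\<in>UNIV. lookup \<alpha> i)"

definition X_pow :: "'v mon \<Rightarrow> ('v, 'r::comm_ring_1) mpol" where
  "X_pow \<alpha> = Poly_Mapping.single \<alpha> 1"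

definition const :: "'r::comm_ring_1 \<Rightarrow> ('v, 'r) mpol" where
  "const c = Poly_Mapping.single 0 c"

definition ring_on :: "'a::comm_ring_1 set \<Rightarrow> 'a ring" where
  "ring_on R = \<lparr>carrier = R, monoid.mult = (*), one = 1, zero = 0, add = (+)\<rparr>"

abbreviation ring_P :: "('n::finite, 'k::comm_ring_1) mpol ring" where
  "ring_P \<equiv> ring_on UNIV"

definition w_component :: "('v mon \<Rightarrow> 'g) \<Rightarrow> 'g \<Rightarrow> ('v, 'r::comm_ring_1) mpol \<Rightarrow> ('v, 'r) mpol" where
  "w_component w g f = (\<Sum>m\<in>{m \<in> keys f. w m = g}. Poly_Mapping.single m (lookup f m))"

definition w_homogeneous :: "('v mon \<Rightarrow> 'g) \<Rightarrow> ('v, 'r::comm_ring_1) mpol set \<Rightarrow> bool" where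
  "w_homogeneous w I \<longleftrightarrow> (\<forall>f\<in>I. \<forall>g. w_component w g f \<in> I)"

definition monomial_ideal :: "('n::finite, 'k::comm_ring_1) mpol set \<Rightarrow> bool" where
  "monomial_ideal J \<longleftrightarrow> (\<exists>S. J = Idl\<^bsub>ring_P\<^esub> (X_pow ` S))"

definition mons_in :: "('n::finite, 'k::comm_ring_1) mpol set \<Rightarrow> 'n mon set" where
  "mons_in J = {\<alpha>. X_pow \<alpha> \<in> J}"

definition mons_out :: "('n::finite, 'k::comm_ring_1) mpol set \<Rightarrow> 'n mon set" where
  "mons_out J = {\<alpha>. X_pow \<alpha> \<notin> J}"

definition min_gens :: "('n::finite, 'k::comm_ring_1) mpol set \<Rightarrow> 'n mon set" where
  "min_gens J = {\<alpha> \<in> mons_in J. \<forall>\<beta>\<in>mons_in J. (\<exists>\<delta>. \<alpha> = \<delta> + \<beta>) \<longrightarrow> \<beta> = \<alpha>}"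

definition deg_part :: "nat \<Rightarrow> ('n::finite, 'k::comm_ring_1) mpol set \<Rightarrow> ('n, 'k) mpol set" where
  "deg_part m J = {f \<in> J. \<forall>\<alpha>\<in>keys f. mdeg \<alpha> = m}"

definition vdim :: "('n::finite, 'k::field) mpol set \<Rightarrow> nat" where
  "vdim V = vector_space.dim (\<lambda>c f. const c * f) V"

definition up_move :: "'n::{finite,linorder} mon \<Rightarrow> 'n mon \<Rightarrow> bool" where
  "up_move \<alpha> \<beta> \<longleftrightarrow> (\<exists>\<delta> i j. i < j \<and>
     \<alpha> = \<delta> + Poly_Mapping.single i 1 \<and> \<beta> = \<delta> + Poly_Mapping.single j 1)"

definition strongly_stable :: "('n::{finite,linorder}, 'k::comm_ring_1) mpol set \<Rightarrow> bool" where
  "strongly_stable J \<longleftrightarrow> (\<forall>\<beta>\<in>mons_in J. \<forall>\<alpha>. up_move\<^sup>+\<^sup>+ \<beta> \<alpha> \<longrightarrow> \<alpha> \<in> mons_in J)"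

text \<open>
  The classes of the monomials in \<open>M\<close> form a \<open>k\<close>-basis of \<open>P / I\<close>: a \<open>k\<close>-linear combination of
  monomials of \<open>M\<close>, i.e. a polynomial with \<open>keys p \<subseteq> M\<close>, which is zero modulo \<open>I\<close> has all its
  coefficients zero (linear independence), and every polynomial is congruent modulo \<open>I\<close> to such a
  linear combination (generation).
\<close>

definition basis_of_quotient :: "'n::finite mon set \<Rightarrow> ('n, 'k::comm_ring_1) mpol set \<Rightarrow> bool" where
  "basis_of_quotient M I \<longleftrightarrow>
     (\<forall>p. keys p \<subseteq> M \<and> p \<in> I \<longrightarrow> (\<forall>\<gamma>. lookup p \<gamma> = 0)) \<and>
     (\<forall>f. \<exists>p. keys p \<subseteq> M \<and> f - p \<in> I)"

text \<open>
  The variable \<open>C\<^bsub>\<alpha>\<gamma>\<^esub>\<close> is the pair \<open>(\<alpha>, \<gamma>)\<close>. The type \<open>('n cvar, 'k) mpol\<close> has a variable for each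
  pair of monomials; \<open>k[C]\<close> is its subring of the polynomials involving only variables in \<open>C_vars J\<close>,
  and ideals of \<open>k[C]\<close> are taken with respect to this subring.
\<close>

type_synonym 'n cvar = "'n mon \<times> 'n mon"

definition C_vars :: "('n::finite, 'k::comm_ring_1) mpol set \<Rightarrow> 'n cvar set" where
  "C_vars J = {(\<alpha>, \<gamma>). \<alpha> \<in> min_gens J \<and> \<gamma> \<in> mons_out J \<and> mdeg \<gamma> = mdeg \<alpha>}"

definition ring_kC :: "('n::finite, 'k::comm_ring_1) mpol set \<Rightarrow> ('n cvar, 'k) mpol ring" where
  "ring_kC J = ring_on {p. \<forall>m\<in>keys p. keys m \<subseteq> C_vars J}"

definition C_var :: "'n mon \<Rightarrow> 'n mon \<Rightarrow> ('n cvar, 'k::comm_ring_1) mpol" where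
  "C_var \<alpha> \<gamma> = X_pow (Poly_Mapping.single (\<alpha>, \<gamma>) 1)"

definition F_poly :: "('n::finite, 'k::comm_ring_1) mpol set \<Rightarrow> 'n mon \<Rightarrow> ('n, ('n cvar, 'k) mpol) mpol" where
  "F_poly J \<alpha> = X_pow \<alpha> -
     (\<Sum>\<gamma>\<in>{\<gamma> \<in> mons_out J. mdeg \<gamma> = mdeg \<alpha>}. const (C_var \<alpha> \<gamma>) * X_pow \<gamma>)"

text \<open>A pair \<open>(\<delta>, \<alpha>)\<close> stands for the product \<open>X\<^sup>\<delta> F\<^sub>\<alpha>\<close>.\<close>

definition XF :: "('n::finite, 'k::comm_ring_1) mpol set \<Rightarrow> 'n mon \<times> 'n mon
    \<Rightarrow> ('n, ('n cvar, 'k) mpol) mpol" where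
  "XF J w = X_pow (fst w) * F_poly J (snd w)"

definition A_rows :: "('n::finite, 'k::comm_ring_1) mpol set \<Rightarrow> nat \<Rightarrow> ('n mon \<times> 'n mon) set" where
  "A_rows J m = {(\<beta>, \<alpha>). \<alpha> \<in> min_gens J \<and> mdeg (\<beta> + \<alpha>) = m}"

text \<open>
  A minor of order \<open>r\<close> is given by \<open>r\<close> distinct rows and \<open>r\<close> distinct columns, listed in any order
  (the order of rows and columns of \<open>A\<^sub>m\<close> only affects the signs of its minors).
\<close>

definition A_minors :: "('n::finite, 'k::comm_ring_1) mpol set \<Rightarrow> nat \<Rightarrow> nat \<Rightarrow> ('n cvar, 'k) mpol set" where
  "A_minors J m r =
     {det (mat r r (\<lambda>(i, j). lookup (XF J (rs ! i)) (cs ! j))) | rs cs.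
        distinct rs \<and> length rs = r \<and> set rs \<subseteq> A_rows J m \<and>
        distinct cs \<and> length cs = r \<and> set cs \<subseteq> {\<gamma>. mdeg \<gamma> = m}}"

definition ideal_A :: "('n::finite, 'k::field) mpol set \<Rightarrow> ('n cvar, 'k) mpol set" where
  "ideal_A J = Idl\<^bsub>ring_kC J\<^esub> (\<Union>m. A_minors J m (vdim (deg_part m J) + 1))"

definition eval_at :: "('v \<Rightarrow> 'k) \<Rightarrow> ('v, 'k::comm_ring_1) mpol \<Rightarrow> 'k" where
  "eval_at c p = (\<Sum>m\<in>keys p. lookup p m * (\<Prod>v\<in>keys m. c v ^ lookup m v))"

text \<open>
  Since \<open>k\<close> is algebraically closed, the closed points of the subscheme of the affine space \<open>k\<^sup>N\<close>
  defined by \<open>\<AA>\<close> are the points of \<open>k\<^sup>N\<close> at which all the elements of \<open>\<AA>\<close> vanish.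
\<close>

definition stratum_points :: "('n::finite, 'k::field) mpol set \<Rightarrow> ('n cvar \<Rightarrow> 'k) set" where
  "stratum_points J = {c \<in> C_vars J \<rightarrow>\<^sub>E UNIV. \<forall>p\<in>ideal_A J. eval_at c p = 0}"

definition origin :: "('n::finite, 'k::comm_ring_1) mpol set \<Rightarrow> 'n cvar \<Rightarrow> 'k" where
  "origin J = (\<lambda>v\<in>C_vars J. 0)"

definition specialize :: "('n cvar \<Rightarrow> 'k) \<Rightarrow> ('n, ('n cvar, 'k::comm_ring_1) mpol) mpol
    \<Rightarrow> ('n, 'k) mpol" where
  "specialize c = Poly_Mapping.map (eval_at c)"

definition ideal_at :: "('n::finite, 'k::comm_ring_1) mpol set \<Rightarrow> ('n cvar \<Rightarrow> 'k) \<Rightarrow> ('n, 'k) mpol set" where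
  "ideal_at J c = Idl\<^bsub>ring_P\<^esub> ((\<lambda>\<alpha>. specialize c (F_poly J \<alpha>)) ` min_gens J)"

text \<open>
  The grading over \<open>\<int>\<^sup>n\<^sup>+\<^sup>1\<close> with \<open>\<lambda>(C\<^bsub>\<alpha>\<gamma>\<^esub>) = \<alpha> - \<gamma>\<close>, extended additively to monomials in \<open>C\<close>.
\<close>

definition C_weight :: "'n cvar mon \<Rightarrow> ('n \<Rightarrow> int)" where
  "C_weight m = (\<lambda>i. \<Sum>v\<in>keys m.
     int (lookup m v) * (int (lookup (fst v) i) - int (lookup (snd v) i)))"

definition head :: "'n mon \<times> 'n mon \<Rightarrow> 'n mon" where
  "head w = fst w + snd w"

definition tail :: "('n::finite, 'k::comm_ring_1) mpol set \<Rightarrow> 'n mon \<times> 'n mon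
    \<Rightarrow> ('n, ('n cvar, 'k) mpol) mpol" where
  "tail J w = X_pow (head w) - XF J w"

definition W_set :: "('n::finite, 'k::comm_ring_1) mpol set \<Rightarrow> nat \<Rightarrow> ('n mon \<times> 'n mon) set" where
  "W_set J m = {w. snd w \<in> min_gens J \<and> head w \<in> mons_in J \<and> mdeg (head w) = m}"

text \<open>\<open>W_gt w w'\<close>: the first non-zero entry of \<open>\<delta>' - \<delta>\<close> is positive, for \<open>w = (\<delta>, \<alpha>)\<close> and \<open>w' = (\<delta>', \<alpha>')\<close>.\<close>

definition W_gt :: "'n::{finite,linorder} mon \<times> 'n mon \<Rightarrow> 'n mon \<times> 'n mon \<Rightarrow> bool" where
  "W_gt w w' \<longleftrightarrow> (\<exists>i. (\<forall>j<i. lookup (fst w') j = lookup (fst w) j) \<and>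
     lookup (fst w') i > lookup (fst w) i)"

definition V_set :: "('n::{finite,linorder}, 'k::comm_ring_1) mpol set \<Rightarrow> nat \<Rightarrow> ('n mon \<times> 'n mon) set" where
  "V_set J m = {w \<in> W_set J m. \<forall>w'\<in>W_set J m. head w' = head w \<and> w' \<noteq> w \<longrightarrow> W_gt w' w}"

definition red_step :: "('n::{finite,linorder}, 'k::comm_ring_1) mpol set
    \<Rightarrow> ('n, ('n cvar, 'k) mpol) mpol \<Rightarrow> ('n, ('n cvar, 'k) mpol) mpol \<Rightarrow> bool" where
  "red_step J h h' \<longleftrightarrow> (\<exists>m. \<exists>w \<in> V_set J m. head w \<in> keys h \<and>
     h' = h - const (lookup h (head w)) * X_pow (head w) + const (lookup h (head w)) * tail J w)"

definition complete_red :: "('n::{finite,linorder}, 'k::comm_ring_1) mpol set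
    \<Rightarrow> ('n, ('n cvar, 'k) mpol) mpol \<Rightarrow> ('n, ('n cvar, 'k) mpol) mpol" where
  "complete_red J h = (THE g. (red_step J)\<^sup>*\<^sup>* h g \<and> keys g \<subseteq> mons_out J)"

text \<open>
  The pairs of products \<open>X\<^sup>\<delta> F\<^sub>\<alpha>\<close>, \<open>X\<^bsup>\<delta>'\<^esup> F\<^bsub>\<alpha>'\<^esub>\<close> whose difference is an S-polynomial: the common
  head is the least common multiple of \<open>X\<^sup>\<alpha>\<close> and \<open>X\<^bsup>\<alpha>'\<^esup>\<close>.
\<close>

definition S_pairs :: "('n::finite, 'k::comm_ring_1) mpol set
    \<Rightarrow> (('n mon \<times> 'n mon) \<times> ('n mon \<times> 'n mon)) set" where
  "S_pairs J = {(w, w'). snd w \<in> min_gens J \<and> snd w' \<in> min_gens J \<and> head w = head w' \<and>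
     (\<forall>i. lookup (head w) i = max (lookup (snd w) i) (lookup (snd w') i))}"

definition ideal_R :: "('n::{finite,linorder}, 'k::comm_ring_1) mpol set \<Rightarrow> ('n cvar, 'k) mpol set" where
  "ideal_R J = Idl\<^bsub>ring_kC J\<^esub>
     {lookup (complete_red J (XF J w - XF J w')) \<gamma> | w w' \<gamma>. (w, w') \<in> S_pairs J}"

definition ideal_R' :: "('n::{finite,linorder}, 'k::comm_ring_1) mpol set \<Rightarrow> ('n cvar, 'k) mpol set" where
  "ideal_R' J = Idl\<^bsub>ring_kC J\<^esub>
     {lookup (complete_red J (XF J w - XF J w')) \<gamma> | w w' \<gamma>.
        (w, w') \<in> S_pairs J \<and> w \<in> V_set J (mdeg (head w))}"

end

theory Submission
  imports Defs
begin

text \<open>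
  Every monomial of \<open>J\<close> has a unique decomposition \<open>X\<^sup>\<delta> X\<^sup>\<alpha>\<close> with \<open>X\<^sup>\<alpha>\<close> a minimal generator and
  no variable of \<open>X\<^sup>\<delta>\<close> larger than a variable of \<open>X\<^sup>\<alpha>\<close> (Eliahou-Kervaire), and the corresponding
  products \<open>X\<^sup>\<delta> F\<^sub>\<alpha>\<close> are those used by the reduction process. A reduction step lowers \<open>\<delta>\<close> in the
  lexicographic order whose most significant variable is the largest one, so that complete
  reduction is a well-defined \<open>k[C]\<close>-linear map \<open>NF\<close>, which vanishes on these products. Row
  operations on \<open>A\<^sub>m\<close> and a Buchberger-type induction on \<open>\<delta>\<close> show that \<open>\<AA>\<close>, \<open>\<RR>\<close> and \<open>\<RR>'\<close> are
  all generated by the coefficients of the polynomials \<open>NF (X\<^sup>\<delta> F\<^sub>\<alpha>)\<close>. A point of \<open>k\<^sup>N\<close> therefore lies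
  in the stratum iff the specialization of \<open>NF\<close> kills the specialized ideal, i.e. iff no nonzero
  combination of monomials outside \<open>J\<close> lies in that ideal.
\<close>

section \<open>Polynomials as finitely supported functions\<close>

text \<open>The obstacle is that X^\<alpha> need not be the leading term of F_\<alpha> for any term
  order: the tail contains all monomials of the same degree outside J. So neither termination of the
  reduction nor Buchberger's criterion comes for free. Strong stability takes the place of a term
  order, because what descends is the cofactor \<delta> and not the monomial itself. The order of
  the minors has a simple origin. There is one minimal product for each monomial of J_m, and these
  dim J_m rows of A_m are always independent; the minors of the next order say that no further row
  contributes anything new. Since the three ideals must agree as ideals of k[C], and not only in
  their zeros, every row operation has coefficients in k[C] and nothing is ever divided.\<close>

lemma lookup_single_mult:
  fixes p :: "'v mon \<Rightarrow>\<^sub>0 'r::comm_ring_1"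
  shows "lookup (Poly_Mapping.single a c * p) (a + g) = c * lookup p g"
proof -
  have "lookup (Poly_Mapping.single a c * p) (a + g)
      = (\<Sum>l. c * (\<Sum>q. lookup p q when a + g = l + q) when a = l)"
    by (simp add: lookup_mult lookup_single when_mult)
  also have "\<dots> = c * lookup p g" by simp
  finally show ?thesis .
qed

lemma lookup_single_mult_outside:
  fixes p :: "'v mon \<Rightarrow>\<^sub>0 'r::comm_ring_1"
  assumes "\<And>g. b \<noteq> a + g"
  shows "lookup (Poly_Mapping.single a c * p) b = 0"
proof -
  have "lookup (Poly_Mapping.single a c * p) b
      = (\<Sum>l. c * (\<Sum>q. lookup p q when b = l + q) when a = l)"
    by (simp add: lookup_mult lookup_single when_mult)
  also have "\<dots> = 0" using assms by simp
  finally show ?thesis .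
qed

lemma lookup_const_mult [simp]:
  "lookup (const c * p) g = c * lookup p g" for p :: "('v, 'r::comm_ring_1) mpol"
  using lookup_single_mult[of 0 c p g] by (simp add: const_def)

lemma const_simps [simp]:
  "const 0 = (0 :: ('v, 'r::comm_ring_1) mpol)" "const 1 = (1 :: ('v, 'r) mpol)"
  by (simp_all add: const_def)

lemma const_add: "const (a + b) = (const a + const b :: ('v, 'r::comm_ring_1) mpol)"
  by (simp add: const_def single_add)

lemma const_uminus: "const (- a) = (- const a :: ('v, 'r::comm_ring_1) mpol)"
  by (simp add: const_def single_uminus)

lemma const_mult: "const (a * b) = (const a * const b :: ('v, 'r::comm_ring_1) mpol)"
  by (simp add: const_def mult_single)

lemma X_pow_add: "X_pow (a + b) = (X_pow a * X_pow b :: ('v, 'r::comm_ring_1) mpol)"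
  by (simp add: X_pow_def mult_single)

lemma X_pow_0 [simp]: "X_pow 0 = (1 :: ('v, 'r::comm_ring_1) mpol)"
  by (simp add: X_pow_def)

lemma const_mult_X_pow:
  "const c * X_pow a = (Poly_Mapping.single a c :: ('v, 'r::comm_ring_1) mpol)"
  by (simp add: const_def X_pow_def mult_single)

lemma keys_X_pow [simp]: "keys (X_pow a :: ('v, 'r::comm_ring_1) mpol) = {a}"
  by (simp add: X_pow_def)

lemma lookup_X_pow: "lookup (X_pow a :: ('v, 'r::comm_ring_1) mpol) b = (if a = b then 1 else 0)"
  by (simp add: X_pow_def lookup_single when_def)

lemma keys_const_mult: "keys (const c * p) \<subseteq> keys p" for p :: "('v, 'r::comm_ring_1) mpol"
  by (auto simp: in_keys_iff)

lemma sum_singles_superset: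
  assumes "finite A" "keys p \<subseteq> A"
  shows "p = (\<Sum>m\<in>A. Poly_Mapping.single m (lookup p m))"
  by (rule poly_mapping_eqI)
    (use assms in \<open>auto simp: lookup_sum lookup_single when_def not_in_keys_iff_lookup_eq_zero
      simp flip: not_in_keys_iff_lookup_eq_zero\<close>)

lemma sum_singles: "p = (\<Sum>m\<in>keys p. Poly_Mapping.single m (lookup p m))"
  by (rule sum_singles_superset) auto

lemma mpol_induct [case_names zero single add]:
  fixes p :: "('v, 'r::comm_ring_1) mpol"
  assumes "P 0" "\<And>m c. P (Poly_Mapping.single m c)" "\<And>p q. P p \<Longrightarrow> P q \<Longrightarrow> P (p + q)"
  shows "P p"
proof -
  have "P (\<Sum>m\<in>A. Poly_Mapping.single m (lookup p m))" if "finite A" for A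
    using that by (induction A) (auto intro: assms)
  then show ?thesis by (subst sum_singles) simp
qed

section \<open>Linear extension of maps defined on monomials\<close>

definition lin_ext :: "('v mon \<Rightarrow> ('w, 'r) mpol) \<Rightarrow> ('v, 'r::comm_ring_1) mpol \<Rightarrow> ('w, 'r) mpol" where
  "lin_ext g h = (\<Sum>m\<in>keys h. const (lookup h m) * g m)"

lemma lin_ext_superset:
  assumes "finite A" "keys h \<subseteq> A"
  shows "lin_ext g h = (\<Sum>m\<in>A. const (lookup h m) * g m)"
  unfolding lin_ext_def
  by (rule sum.mono_neutral_left) (use assms in \<open>auto simp: not_in_keys_iff_lookup_eq_zero\<close>)

lemma lin_ext_add: "lin_ext g (p + q) = lin_ext g p + lin_ext g q"
proof -
  have "keys (p + q) \<subseteq> keys p \<union> keys q" by (rule keys_add)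
  then show ?thesis
    by (simp add: lin_ext_superset[of "keys p \<union> keys q"] lookup_add const_add
        distrib_right sum.distrib)
qed

lemma lin_ext_zero [simp]: "lin_ext g 0 = 0"
  by (simp add: lin_ext_def)

lemma lin_ext_const_mult: "lin_ext g (const c * p) = const c * lin_ext g p"
  using keys_const_mult[of c p]
  by (simp add: lin_ext_superset[of "keys p"] const_mult sum_distrib_left mult.assoc)

lemma lin_ext_uminus: "lin_ext g (- p) = - lin_ext g p"
  using lin_ext_const_mult[of g "- 1" p] by (simp add: const_uminus)

lemma lin_ext_diff: "lin_ext g (p - q) = lin_ext g p - lin_ext g q"
  using lin_ext_add[of g p "- q"] by (simp add: lin_ext_uminus)

lemma lin_ext_sum: "lin_ext g (sum f A) = (\<Sum>a\<in>A. lin_ext g (f a))"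
  by (induction A rule: infinite_finite_induct) (auto simp: lin_ext_add)

lemma lin_ext_X_pow [simp]: "lin_ext g (X_pow a) = g a"
  by (simp add: lin_ext_def lookup_X_pow)

lemma lookup_lin_ext: "lookup (lin_ext g h) b = (\<Sum>m\<in>keys h. lookup h m * lookup (g m) b)"
  by (simp add: lin_ext_def lookup_sum)

section \<open>Evaluation and specialization\<close>

definition mon_eval :: "('v \<Rightarrow> 'k::comm_ring_1) \<Rightarrow> 'v mon \<Rightarrow> 'k" where
  "mon_eval c m = (\<Prod>v\<in>keys m. c v ^ lookup m v)"

lemma mon_eval_superset:
  assumes "finite A" "keys m \<subseteq> A"
  shows "mon_eval c m = (\<Prod>v\<in>A. c v ^ lookup m v)"
  unfolding mon_eval_def
  by (rule prod.mono_neutral_left) (use assms in \<open>auto simp: not_in_keys_iff_lookup_eq_zero\<close>)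

lemma mon_eval_add: "mon_eval c (m + m') = mon_eval c m * mon_eval c m'"
proof -
  have "keys (m + m') \<subseteq> keys m \<union> keys m'" by (rule keys_add)
  then show ?thesis
    by (simp add: mon_eval_superset[of "keys m \<union> keys m'"] lookup_add power_add prod.distrib)
qed

lemma eval_at_superset:
  assumes "finite A" "keys p \<subseteq> A"
  shows "eval_at c p = (\<Sum>m\<in>A. lookup p m * mon_eval c m)"
  unfolding eval_at_def mon_eval_def[symmetric]
  by (rule sum.mono_neutral_left) (use assms in \<open>auto simp: not_in_keys_iff_lookup_eq_zero\<close>)

lemma eval_at_add: "eval_at c (p + q) = eval_at c p + eval_at c q"
proof -
  have "keys (p + q) \<subseteq> keys p \<union> keys q" by (rule keys_add)
  then show ?thesis
    by (simp add: eval_at_superset[of "keys p \<union> keys q"] lookup_add distrib_right sum.distrib)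
qed

lemma eval_at_zero [simp]: "eval_at c 0 = 0"
  by (simp add: eval_at_def)

lemma eval_at_single [simp]: "eval_at c (Poly_Mapping.single m a) = a * mon_eval c m"
  by (simp add: eval_at_def mon_eval_def)

lemma eval_at_one [simp]: "eval_at c 1 = 1"
  using eval_at_single[of c 0 1] by (simp add: mon_eval_def)

lemma eval_at_mult: "eval_at c (p * q) = eval_at c p * eval_at c q"
proof (induction p rule: mpol_induct)
  case (single m a)
  show ?case
    by (induction q rule: mpol_induct)
      (simp_all add: mult_single mon_eval_add eval_at_add algebra_simps)
qed (simp_all add: distrib_right eval_at_add)

lemma eval_at_uminus: "eval_at c (- p) = - eval_at c p"
  using eval_at_add[of c p "- p"] by (simp add: eq_neg_iff_add_eq_0 add.commute)

lemma eval_at_diff: "eval_at c (p - q) = eval_at c p - eval_at c q"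
  using eval_at_add[of c p "- q"] by (simp add: eval_at_uminus)

lemma eval_at_sum: "eval_at c (sum f A) = (\<Sum>a\<in>A. eval_at c (f a))"
  by (induction A rule: infinite_finite_induct) (auto simp: eval_at_add)

lemma eval_at_C_var [simp]: "eval_at c (C_var \<alpha> \<gamma>) = c (\<alpha>, \<gamma>)"
  by (simp add: C_var_def X_pow_def mon_eval_def)

lemma lookup_specialize [simp]: "lookup (specialize c h) g = eval_at c (lookup h g)"
  unfolding specialize_def by (simp add: Poly_Mapping.map.rep_eq when_def)

lemma specialize_zero [simp]: "specialize c 0 = 0"
  by (rule poly_mapping_eqI) simp

lemma specialize_add: "specialize c (p + q) = specialize c p + specialize c q"
  by (rule poly_mapping_eqI) (simp add: lookup_add eval_at_add)

lemma specialize_diff: "specialize c (p - q) = specialize c p - specialize c q"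
  by (rule poly_mapping_eqI) (simp add: lookup_minus eval_at_diff)

lemma specialize_sum: "specialize c (sum f A) = (\<Sum>a\<in>A. specialize c (f a))"
  by (rule poly_mapping_eqI) (simp add: lookup_sum eval_at_sum)

lemma specialize_const_mult: "specialize c (const a * p) = const (eval_at c a) * specialize c p"
  by (rule poly_mapping_eqI) (simp add: eval_at_mult)

lemma specialize_X_pow [simp]: "specialize c (X_pow a) = X_pow a"
  by (rule poly_mapping_eqI) (simp add: lookup_X_pow)

lemma specialize_X_pow_mult: "specialize c (X_pow a * p) = X_pow a * specialize c p"
proof (rule poly_mapping_eqI)
  fix b
  show "lookup (specialize c (X_pow a * p)) b = lookup (X_pow a * specialize c p) b"
  proof (cases "\<exists>g. b = a + g")
    case True
    then show ?thesis by (auto simp: X_pow_def lookup_single_mult)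
  next
    case False
    then show ?thesis by (simp add: X_pow_def lookup_single_mult_outside)
  qed
qed

section \<open>Ideals of subrings\<close>

text \<open>k[C] is a subset of a type that has a variable for every pair of monomials, whereas P is
  a whole type. The locale treats the ideals of both, with \<open>S = UNIV\<close> for P.\<close>

locale subring_set =
  fixes S :: "'a::comm_ring_1 set"
  assumes one_closed: "1 \<in> S"
    and diff_closed: "a \<in> S \<Longrightarrow> b \<in> S \<Longrightarrow> a - b \<in> S"
    and mult_closed: "a \<in> S \<Longrightarrow> b \<in> S \<Longrightarrow> a * b \<in> S"
begin

lemma zero_closed: "0 \<in> S"
  using diff_closed[OF one_closed one_closed] by simp

lemma uminus_closed: "a \<in> S \<Longrightarrow> - a \<in> S"
  using diff_closed[OF zero_closed] by simp

lemma add_closed: "a \<in> S \<Longrightarrow> b \<in> S \<Longrightarrow> a + b \<in> S"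
  using diff_closed[OF _ uminus_closed] by fastforce

lemma sum_closed: "(\<And>x. x \<in> A \<Longrightarrow> f x \<in> S) \<Longrightarrow> sum f A \<in> S"
  by (induction A rule: infinite_finite_induct) (auto intro: zero_closed add_closed)

lemma prod_closed: "(\<And>x. x \<in> A \<Longrightarrow> f x \<in> S) \<Longrightarrow> prod f A \<in> S"
  by (induction A rule: infinite_finite_induct) (auto intro: one_closed mult_closed)

lemma signof_closed: "signof p \<in> S"
  by (auto simp: sign_def intro: one_closed uminus_closed)

lemma det_closed:
  assumes "A \<in> carrier_mat n n" "\<And>i j. i < n \<Longrightarrow> j < n \<Longrightarrow> A $$ (i, j) \<in> S"
  shows "det A \<in> S"
  unfolding det_def'[OF assms(1)]
  by (intro sum_closed mult_closed signof_closed prod_closed assms(2))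
    (auto simp: permutes_in_image dest: permutes_in_image)

lemma ring_ring_on: "ring (ring_on S)"
  by (unfold_locales)
    (auto simp: ring_on_def Units_def algebra_simps one_closed zero_closed add_closed mult_closed
      intro!: bexI[of _ "- _"] uminus_closed)

text \<open>Multiplication by -1 gives negatives and commutativity gives the other multiplication
  law, so that ideals can be handled by the operations of the type alone.\<close>

lemma ideal_ring_on_iff:
  "ideal I (ring_on S) \<longleftrightarrow>
     I \<subseteq> S \<and> 0 \<in> I \<and> (\<forall>a\<in>I. \<forall>b\<in>I. a + b \<in> I) \<and> (\<forall>s\<in>S. \<forall>a\<in>I. s * a \<in> I)"
  (is "?l \<longleftrightarrow> ?r")
proof
  assume ?l
  then interpret ideal I "ring_on S" .
  have sub: "additive_subgroup I (ring_on S)" ..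
  show ?r
    using a_subset additive_subgroup.zero_closed[OF sub] additive_subgroup.a_closed[OF sub]
      I_l_closed
    by (auto simp: ring_on_def)
next
  assume r: ?r
  have minus: "- a \<in> I" if "a \<in> I" for a
    using r uminus_closed[OF one_closed] that by force
  interpret ring "ring_on S" by (rule ring_ring_on)
  have inv: "\<ominus>\<^bsub>ring_on S\<^esub> a = - a" if "a \<in> S" for a
    by (rule minus_equality) (use that in \<open>auto simp: ring_on_def intro: uminus_closed\<close>)
  show ?l
  proof (rule idealI)
    show "subgroup I (add_monoid (ring_on S))"
      by (rule group.subgroupI[OF a_group])
        (use r minus inv in \<open>auto simp: ring_on_def a_inv_def\<close>)
    show "ring (ring_on S)" by (rule ring_ring_on)
    show "x \<otimes>\<^bsub>ring_on S\<^esub> a \<in> I" "a \<otimes>\<^bsub>ring_on S\<^esub> x \<in> I"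
      if "a \<in> I" "x \<in> carrier (ring_on S)" for a x
      using r that by (auto simp: ring_on_def mult.commute[of a x])
  qed
qed

end

context
  fixes S I :: "'a::comm_ring_1 set"
  assumes S: "subring_set S" and I: "ideal I (ring_on S)"
begin

interpretation subring_set S by (rule S)

lemma ideal_on_subset: "I \<subseteq> S"
  and ideal_on_zero: "0 \<in> I"
  and ideal_on_add: "a \<in> I \<Longrightarrow> b \<in> I \<Longrightarrow> a + b \<in> I"
  and ideal_on_mult: "s \<in> S \<Longrightarrow> a \<in> I \<Longrightarrow> s * a \<in> I"
  using I by (auto simp: ideal_ring_on_iff)

lemma ideal_on_mult_right: "s \<in> S \<Longrightarrow> a \<in> I \<Longrightarrow> a * s \<in> I"
  using ideal_on_mult[of s a] by (simp add: mult.commute)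

lemma ideal_on_uminus: "a \<in> I \<Longrightarrow> - a \<in> I"
  using ideal_on_mult[of "- 1" a] one_closed uminus_closed by auto

lemma ideal_on_diff: "a \<in> I \<Longrightarrow> b \<in> I \<Longrightarrow> a - b \<in> I"
  using ideal_on_add[OF _ ideal_on_uminus] by fastforce

lemma ideal_on_sum: "(\<And>x. x \<in> A \<Longrightarrow> f x \<in> I) \<Longrightarrow> sum f A \<in> I"
  by (induction A rule: infinite_finite_induct) (auto intro: ideal_on_zero ideal_on_add)

lemma prod_cong_mod_ideal:
  assumes "\<And>x. x \<in> A \<Longrightarrow> f x \<in> S \<and> g x \<in> S \<and> f x - g x \<in> I"
  shows "prod f A - prod g A \<in> I"
  using assms
proof (induction A rule: infinite_finite_induct)
  case (insert x A)
  \<comment> \<open>One factor is exchanged at a time, so that the difference telescopes.\<close>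
  have "prod f (insert x A) - prod g (insert x A)
      = prod f A * (f x - g x) + g x * (prod f A - prod g A)"
    using insert by (simp add: algebra_simps)
  also have "\<dots> \<in> I"
    using insert by (intro ideal_on_add ideal_on_mult prod_closed) auto
  finally show ?case .
qed (auto simp: ideal_on_zero)

text \<open>Each product in the Leibniz formula changes by an element of \<open>I\<close>. This
  permits replacing the entries of a minor modulo \<open>I\<close>.\<close>

lemma det_cong_mod_ideal:
  assumes AB: "A \<in> carrier_mat n n" "B \<in> carrier_mat n n"
    and "\<And>i j. i < n \<Longrightarrow> j < n \<Longrightarrow>
           A $$ (i, j) \<in> S \<and> B $$ (i, j) \<in> S \<and> A $$ (i, j) - B $$ (i, j) \<in> I"
  shows "det A - det B \<in> I"
proof -
  have "(\<Prod>i = 0..<n. A $$ (i, p i)) - (\<Prod>i = 0..<n. B $$ (i, p i)) \<in> I"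
    if "p permutes {0..<n}" for p
    by (rule prod_cong_mod_ideal, rule assms(3)) (use permutes_in_image[OF that] in auto)
  then show ?thesis
    unfolding det_def'[OF AB(1)] det_def'[OF AB(2)] sum_subtractf[symmetric]
      right_diff_distrib[symmetric]
    by (intro ideal_on_sum ideal_on_mult signof_closed) auto
qed

end

lemma subring_set_UNIV: "subring_set UNIV"
  by unfold_locales auto

lemma
  assumes "subring_set S" "G \<subseteq> S"
  shows ideal_genideal_on: "ideal (Idl\<^bsub>ring_on S\<^esub> G) (ring_on S)"
    and genideal_on_self: "G \<subseteq> Idl\<^bsub>ring_on S\<^esub> G"
proof -
  interpret ring "ring_on S" by (rule subring_set.ring_ring_on) fact
  have *: "G \<subseteq> carrier (ring_on S)" using assms(2) by (simp add: ring_on_def)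
  show "ideal (Idl\<^bsub>ring_on S\<^esub> G) (ring_on S)" by (rule genideal_ideal[OF *])
  show "G \<subseteq> Idl\<^bsub>ring_on S\<^esub> G" by (rule genideal_self[OF *])
qed

lemma genideal_on_minimal: "ideal I (ring_on S) \<Longrightarrow> G \<subseteq> I \<Longrightarrow> Idl\<^bsub>ring_on S\<^esub> G \<subseteq> I"
  by (auto simp: genideal_def)

section \<open>Monomials\<close>

abbreviation var :: "'v \<Rightarrow> 'v mon" where
  "var i \<equiv> Poly_Mapping.single i 1"

lemma mdeg_add [simp]: "mdeg (a + b) = mdeg a + mdeg b"
  by (simp add: mdeg_def lookup_add sum.distrib)

lemma mdeg_var [simp]: "mdeg (Poly_Mapping.single i (Suc 0)) = 1"
  by (simp add: mdeg_def lookup_single when_def)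

lemma finite_mdeg_le: "finite {a :: 'n::finite mon. mdeg a \<le> m}"
proof (rule finite_imageD)
  have "lookup a i \<le> m" if "mdeg a \<le> m" for a :: "'n mon" and i
    using member_le_sum[of i UNIV "lookup a"] that by (simp add: mdeg_def)
  then have "lookup ` {a :: 'n mon. mdeg a \<le> m} \<subseteq> PiE UNIV (\<lambda>_. {..m})" by auto
  then show "finite (lookup ` {a :: 'n mon. mdeg a \<le> m})"
    by (rule finite_subset) (intro finite_PiE, auto)
  show "inj_on lookup {a :: 'n mon. mdeg a \<le> m}"
    by (rule inj_onI) (simp add: poly_mapping_eqI)
qed

lemma finite_mdeg_in [simp]: "finite {a \<in> A. mdeg (a :: 'n::finite mon) = m}"
  by (rule finite_subset[OF _ finite_mdeg_le[of m]]) auto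

lemma mon_divI:
  fixes a b :: "'v mon"
  assumes "\<And>i. lookup a i \<le> lookup b i"
  shows "\<exists>d. b = d + a"
  by (rule exI[of _ "b - a"], rule poly_mapping_eqI) (simp add: lookup_add lookup_minus assms)

lemma var_divI:
  fixes a :: "'v mon"
  assumes "i \<in> keys a"
  shows "\<exists>d. a = d + var i"
  by (rule mon_divI) (use assms in \<open>auto simp: lookup_single when_def in_keys_iff\<close>)

lemma keys_add_mon [simp]: "keys (a + b) = keys a \<union> keys b" for a b :: "'v mon"
  by (auto simp: in_keys_iff lookup_add)

lemma mon_zero_minimal: "0 = d + a \<Longrightarrow> a = 0" for a d :: "'v mon"
proof (rule poly_mapping_eqI)
  fix i assume "0 = d + a"
  then have "lookup 0 i = lookup (d + a) i" by simp
  then show "lookup a i = lookup 0 i" by (simp add: lookup_add)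
qed

lemma mon_nonzero_keys: "a \<noteq> 0 \<Longrightarrow> keys a \<noteq> {}" for a :: "'v mon"
  by (rule contrapos_nn, assumption, rule poly_mapping_eqI)
    (metis empty_iff in_keys_iff lookup_zero)

text \<open>
  The lexicographic order in which the largest variable is the most significant: the order along
  which the reduction process descends.
\<close>

definition lex_less :: "'n::linorder mon \<Rightarrow> 'n mon \<Rightarrow> bool" where
  "lex_less a b \<longleftrightarrow> (\<exists>i. lookup a i < lookup b i \<and> (\<forall>j>i. lookup a j = lookup b j))"

lemma lex_less_irrefl [simp]: "\<not> lex_less a a"
  by (simp add: lex_less_def)

lemma lex_less_trans:
  assumes "lex_less a b" "lex_less b c"
  shows "lex_less a c"
proof -
  obtain i where i: "lookup a i < lookup b i" "\<forall>j>i. lookup a j = lookup b j"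
    using assms(1) by (auto simp: lex_less_def)
  obtain l where l: "lookup b l < lookup c l" "\<forall>j>l. lookup b j = lookup c j"
    using assms(2) by (auto simp: lex_less_def)
  show ?thesis unfolding lex_less_def
    by (rule exI[of _ "max i l"], cases i l rule: linorder_cases) (use i l in \<open>auto simp: max_def\<close>)
qed

lemma lex_less_linear:
  fixes a b :: "'n::{finite,linorder} mon"
  assumes "a \<noteq> b"
  shows "lex_less a b \<or> lex_less b a"
proof -
  let ?D = "{i. lookup a i \<noteq> lookup b i}"
  have "?D \<noteq> {}" using assms poly_mapping_eqI[of a b] by blast
  then have "Max ?D \<in> ?D" by (intro Max_in) auto
  moreover have "lookup a j = lookup b j" if "j > Max ?D" for j
    using that Max_ge[of ?D j] by (auto simp: not_le[symmetric])
  ultimately show ?thesis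
    unfolding lex_less_def by (metis (mono_tags, lifting) mem_Collect_eq nat_neq_iff)
qed

lemma lex_less_add: "lex_less a b \<Longrightarrow> lex_less (d + a) (d + b)"
  by (auto simp: lex_less_def lookup_add)

text \<open>Turns the lexicographic descent into a descent of natural numbers. The degree is bounded
  by \<open>m\<close> and not fixed, because cofactors of products with a common head may have
  different degrees.\<close>

definition lex_rank :: "nat \<Rightarrow> 'n::{finite,linorder} mon \<Rightarrow> nat" where
  "lex_rank m a = card {b. mdeg b \<le> m \<and> lex_less b a}"

lemma lex_rank_less:
  assumes "lex_less a b" "mdeg a \<le> m"
  shows "lex_rank m a < lex_rank m b"
  unfolding lex_rank_def
proof (rule psubset_card_mono)
  show "finite {c. mdeg c \<le> m \<and> lex_less c b}"
    by (rule finite_subset[OF _ finite_mdeg_le[of m]]) auto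
  show "{c. mdeg c \<le> m \<and> lex_less c a} \<subset> {c. mdeg c \<le> m \<and> lex_less c b}"
  proof (rule psubsetI)
    show "{c. mdeg c \<le> m \<and> lex_less c a} \<subseteq> {c. mdeg c \<le> m \<and> lex_less c b}"
      using assms(1) lex_less_trans by blast
    show "{c. mdeg c \<le> m \<and> lex_less c a} \<noteq> {c. mdeg c \<le> m \<and> lex_less c b}"
      using assms lex_less_irrefl by blast
  qed
qed

section \<open>Homogeneous elements\<close>

lemma lookup_w_component: "lookup (w_component w g f) m = (if w m = g then lookup f m else 0)"
proof -
  have "lookup (w_component w g f) m
      = (\<Sum>n\<in>{n \<in> keys f. w n = g}. lookup f n when n = m)"
    by (simp add: w_component_def lookup_sum lookup_single)
  also have "\<dots> = (if w m = g then lookup f m else 0)"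
    by (auto simp: when_def in_keys_iff)
  finally show ?thesis .
qed

lemma w_component_add: "w_component w g (p + q) = w_component w g p + w_component w g q"
  by (rule poly_mapping_eqI) (simp add: lookup_w_component lookup_add)

lemma w_component_zero [simp]: "w_component w g 0 = 0"
  by (rule poly_mapping_eqI) (simp add: lookup_w_component)

text \<open>By cancellation, a component of the product comes from a single component of
  \<open>f\<close>; it is 0 if \<open>g\<close> is not of the form \<open>w (m + a)\<close>.\<close>

lemma w_component_single_mult:
  assumes w: "\<And>m a b. w (m + a) = w (m + b) \<longleftrightarrow> w a = w b"
  shows "\<exists>h. w_component w g (Poly_Mapping.single m c * f)
           = Poly_Mapping.single m c * w_component w h f
         \<or> w_component w g (Poly_Mapping.single m c * f) = 0"
proof (cases "\<exists>a. w (m + a) = g")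
  case True
  then obtain a where a: "w (m + a) = g" by blast
  have "w_component w g (Poly_Mapping.single m c * f)
      = Poly_Mapping.single m c * w_component w (w a) f"
  proof (rule poly_mapping_eqI)
    fix b
    show "lookup (w_component w g (Poly_Mapping.single m c * f)) b
        = lookup (Poly_Mapping.single m c * w_component w (w a) f) b"
    proof (cases "\<exists>d. b = m + d")
      case True
      then obtain d where b: "b = m + d" by blast
      have "w (m + d) = g \<longleftrightarrow> w d = w a" unfolding a[symmetric] by (rule w)
      then show ?thesis by (simp add: b lookup_single_mult lookup_w_component)
    next
      case False
      then show ?thesis by (auto simp: lookup_single_mult_outside lookup_w_component)
    qed
  qed
  then show ?thesis by blast
next
  case False
  have "w_component w g (Poly_Mapping.single m c * f) = 0"
  proof (rule poly_mapping_eqI)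
    fix b
    show "lookup (w_component w g (Poly_Mapping.single m c * f)) b = lookup 0 b"
      by (cases "\<exists>d. b = m + d")
        (use False in \<open>auto simp: lookup_w_component lookup_single_mult_outside\<close>)
  qed
  then show ?thesis by blast
qed

lemma w_component_homogeneous:
  assumes "\<forall>m\<in>keys f. w m = h"
  shows "w_component w g f = f \<or> w_component w g f = 0"
proof (cases "g = h")
  case True
  then have "w_component w g f = f"
    using assms by (intro poly_mapping_eqI) (auto simp: lookup_w_component in_keys_iff)
  then show ?thesis ..
next
  case False
  then have "w_component w g f = 0"
    using assms by (intro poly_mapping_eqI) (auto simp: lookup_w_component in_keys_iff)
  then show ?thesis ..
qed

text \<open>The members of the ideal all of whose components stay in it form an ideal again, and
  this one contains \<open>G\<close>. Stating the condition on \<open>w\<close> as cancellation lets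
  the lemma serve both \<open>mdeg\<close> and \<open>C_weight\<close>.\<close>

lemma w_homogeneous_genideal:
  fixes G :: "('v, 'r::comm_ring_1) mpol set"
  assumes S: "subring_set S" and G: "G \<subseteq> S"
    and singles: "\<And>s m. s \<in> S \<Longrightarrow> Poly_Mapping.single m (lookup s m) \<in> S"
    and w: "\<And>m a b. w (m + a) = w (m + b) \<longleftrightarrow> w a = w b"
    and hom: "\<And>f. f \<in> G \<Longrightarrow> \<exists>h. \<forall>m\<in>keys f. w m = h"
  shows "w_homogeneous w (Idl\<^bsub>ring_on S\<^esub> G)"
proof -
  let ?I = "Idl\<^bsub>ring_on S\<^esub> G"
  let ?I' = "{f \<in> ?I. \<forall>g. w_component w g f \<in> ?I}"
  note I = ideal_genideal_on[OF S G]
  have "ideal ?I' (ring_on S)"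
    unfolding subring_set.ideal_ring_on_iff[OF S]
  proof (intro conjI ballI)
    show "?I' \<subseteq> S" using ideal_on_subset[OF S I] by auto
    show "0 \<in> ?I'" using ideal_on_zero[OF S I] by auto
    show "a + b \<in> ?I'" if "a \<in> ?I'" "b \<in> ?I'" for a b
      using that ideal_on_add[OF S I] by (auto simp: w_component_add)
    show "s * a \<in> ?I'" if s: "s \<in> S" and a: "a \<in> ?I'" for s a
    proof -
      \<comment> \<open>It is enough to multiply by the single terms of \<open>s\<close>, which
        \<open>singles\<close> keeps in \<open>S\<close>.\<close>
      have *: "w_component w g (Poly_Mapping.single m (lookup s m) * a) \<in> ?I" for g m
        using w_component_single_mult[of w g m "lookup s m" a, OF w]
          ideal_on_mult[OF S I singles[OF s]] ideal_on_zero[OF S I] a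
        by auto
      have "w_component w g ((\<Sum>m\<in>A. Poly_Mapping.single m (lookup s m)) * a) \<in> ?I"
        if "finite A" for A g
        using that
        by (induction A) (auto simp: distrib_right w_component_add
            intro: * ideal_on_zero[OF S I] ideal_on_add[OF S I])
      then have "w_component w g (s * a) \<in> ?I" for g
        using sum_singles[of s] by (metis finite_keys)
      then show ?thesis using ideal_on_mult[OF S I s] a by auto
    qed
  qed
  moreover have "G \<subseteq> ?I'"
  proof
    fix f assume f: "f \<in> G"
    have fI: "f \<in> ?I" using genideal_on_self[OF S G] f by auto
    obtain h where "\<forall>m\<in>keys f. w m = h" using hom[OF f] by blast
    then have "w_component w g f \<in> ?I" for g
      using w_component_homogeneous[of f w h g] ideal_on_zero[OF S I] fI by auto
    then show "f \<in> ?I'" using fI by simp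
  qed
  ultimately have "?I \<subseteq> ?I'" by (rule genideal_on_minimal)
  then show ?thesis unfolding w_homogeneous_def by blast
qed

section \<open>Weights of polynomials in the variables C\<close>

lemma C_weight_superset:
  assumes "finite A" "keys m \<subseteq> A"
  shows "C_weight m i
    = (\<Sum>v\<in>A. int (lookup m v) * (int (lookup (fst v) i) - int (lookup (snd v) i)))"
  unfolding C_weight_def
  by (rule sum.mono_neutral_left) (use assms in \<open>auto simp: not_in_keys_iff_lookup_eq_zero\<close>)

lemma C_weight_add: "C_weight (m + m') i = C_weight m i + C_weight m' i"
  by (simp add: C_weight_superset[of "keys m \<union> keys m'"] lookup_add distrib_right sum.distrib)

lemma C_weight_cancel: "C_weight (m + a) = C_weight (m + b) \<longleftrightarrow> C_weight a = C_weight b"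
  by (simp add: fun_eq_iff C_weight_add)

text \<open>A relation and not a function of \<open>p\<close>, because 0 is homogeneous of every
  weight; sums with vanishing terms then need no special care.\<close>

definition C_hom :: "('n cvar, 'k::comm_ring_1) mpol \<Rightarrow> ('n \<Rightarrow> int) \<Rightarrow> bool" where
  "C_hom p w \<longleftrightarrow> (\<forall>m\<in>keys p. C_weight m = w)"

lemma C_hom_zero [simp]: "C_hom 0 w"
  by (simp add: C_hom_def)

lemma C_hom_one: "C_hom 1 (\<lambda>_. 0)"
  by (simp add: C_hom_def C_weight_def fun_eq_iff)

lemma C_hom_C_var: "C_hom (C_var \<alpha> \<gamma>) (\<lambda>i. int (lookup \<alpha> i) - int (lookup \<gamma> i))"
  by (simp add: C_hom_def C_var_def C_weight_def)

lemma C_hom_uminus: "C_hom p w \<Longrightarrow> C_hom (- p) w"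
  by (simp add: C_hom_def in_keys_iff)

lemma C_hom_add: "C_hom p w \<Longrightarrow> C_hom q w \<Longrightarrow> C_hom (p + q) w"
  using Poly_Mapping.keys_add[of p q] by (auto simp: C_hom_def)

lemma C_hom_sum: "(\<And>x. x \<in> A \<Longrightarrow> C_hom (f x) w) \<Longrightarrow> C_hom (sum f A) w"
  by (induction A rule: infinite_finite_induct) (auto intro: C_hom_add)

lemma C_hom_mult:
  assumes "C_hom p w" "C_hom q w'"
  shows "C_hom (p * q) (\<lambda>i. w i + w' i)"
  unfolding C_hom_def
proof
  fix m assume "m \<in> keys (p * q)"
  then obtain a b where "m = a + b" "a \<in> keys p" "b \<in> keys q" using keys_mult[of p q] by blast
  then show "C_weight m = (\<lambda>i. w i + w' i)"
    using assms by (simp add: C_hom_def C_weight_add fun_eq_iff)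
qed

lemma C_hom_prod:
  assumes "finite A" "\<And>x. x \<in> A \<Longrightarrow> C_hom (f x) (w x)"
  shows "C_hom (prod f A) (\<lambda>i. \<Sum>x\<in>A. w x i)"
  using assms by (induction A) (auto simp: C_hom_one intro: C_hom_mult)

text \<open>With weights of the form row minus column, every term of the Leibniz formula has the
  same weight, whatever the permutation.\<close>

lemma C_hom_det:
  assumes A: "A \<in> carrier_mat n n"
    and hom: "\<And>i j. i < n \<Longrightarrow> j < n \<Longrightarrow> C_hom (A $$ (i, j)) (\<lambda>x. u i x - v j x)"
  shows "C_hom (det A) (\<lambda>x. (\<Sum>i = 0..<n. u i x) - (\<Sum>i = 0..<n. v i x))"
  unfolding det_def'[OF A]
proof (rule C_hom_sum)
  fix p assume "p \<in> {p. p permutes {0..<n}}"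
  then have p: "p permutes {0..<n}" by simp
  have "C_hom (\<Prod>i = 0..<n. A $$ (i, p i)) (\<lambda>x. \<Sum>i = 0..<n. u i x - v (p i) x)"
    by (rule C_hom_prod) (use permutes_in_image[OF p] in \<open>auto intro: hom\<close>)
  moreover have "(\<Sum>i = 0..<n. v (p i) x) = (\<Sum>i = 0..<n. v i x)" for x
    using sum.permute[OF p, of "\<lambda>i. v i x"] by (simp add: comp_def)
  ultimately have "C_hom (\<Prod>i = 0..<n. A $$ (i, p i))
      (\<lambda>x. (\<Sum>i = 0..<n. u i x) - (\<Sum>i = 0..<n. v i x))"
    by (simp add: sum_subtractf)
  then show "C_hom (signof p * (\<Prod>i = 0..<n. A $$ (i, p i)))
      (\<lambda>x. (\<Sum>i = 0..<n. u i x) - (\<Sum>i = 0..<n. v i x))"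
    by (cases "sign p = 1") (auto simp: sign_def C_hom_uminus)
qed

section \<open>Strongly stable monomial ideals\<close>


locale stable_ideal =
  fixes J :: "('n::{finite,linorder}, 'k::field) mpol set"
  assumes monomial: "monomial_ideal J" and stable: "strongly_stable J"
begin

lemma ideal_J: "ideal J ring_P"
  using monomial ideal_genideal_on[OF subring_set_UNIV] by (auto simp: monomial_ideal_def)

lemma mons_in_add: "a \<in> mons_in J \<Longrightarrow> d + a \<in> mons_in J"
  using ideal_on_mult[OF subring_set_UNIV ideal_J, of "X_pow d" "X_pow a"]
  by (simp add: mons_in_def X_pow_add)

lemma mons_out_iff: "a \<in> mons_out J \<longleftrightarrow> a \<notin> mons_in J"
  by (simp add: mons_in_def mons_out_def)

text \<open>The polynomials supported on monomials of J form an ideal that contains the monomial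
  generators, hence all of J.\<close>

lemma in_J_iff: "f \<in> J \<longleftrightarrow> keys f \<subseteq> mons_in J"
proof
  obtain S where S: "J = Idl\<^bsub>ring_P\<^esub> (X_pow ` S)"
    using monomial by (auto simp: monomial_ideal_def)
  have "ideal {f. keys f \<subseteq> mons_in J} ring_P"
    unfolding subring_set.ideal_ring_on_iff[OF subring_set_UNIV]
  proof (intro conjI ballI)
    show "a + b \<in> {f. keys f \<subseteq> mons_in J}"
      if "a \<in> {f. keys f \<subseteq> mons_in J}" "b \<in> {f. keys f \<subseteq> mons_in J}" for a b
      using that Poly_Mapping.keys_add[of a b] by auto
    show "s * a \<in> {f. keys f \<subseteq> mons_in J}" if "a \<in> {f. keys f \<subseteq> mons_in J}" for s a
      using that keys_mult[of s a] mons_in_add by fastforce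
  qed auto
  moreover have "X_pow ` S \<subseteq> {f. keys f \<subseteq> mons_in J}"
    using genideal_on_self[OF subring_set_UNIV subset_UNIV] S by (fastforce simp: mons_in_def)
  ultimately have "J \<subseteq> {f. keys f \<subseteq> mons_in J}"
    using genideal_on_minimal S by blast
  then show "f \<in> J \<Longrightarrow> keys f \<subseteq> mons_in J" by auto
next
  assume f: "keys f \<subseteq> mons_in J"
  have "Poly_Mapping.single m (lookup f m) \<in> J" if "m \<in> keys f" for m
    using ideal_on_mult[OF subring_set_UNIV ideal_J, of "const (lookup f m)" "X_pow m"] f that
    by (auto simp: mons_in_def const_mult_X_pow)
  then have "(\<Sum>m\<in>keys f. Poly_Mapping.single m (lookup f m)) \<in> J"
    by (rule ideal_on_sum[OF subring_set_UNIV ideal_J])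
  then show "f \<in> J" by (simp flip: sum_singles)
qed

lemma mons_in_up: "a + var i \<in> mons_in J \<Longrightarrow> i < j \<Longrightarrow> a + var j \<in> mons_in J"
  using stable unfolding strongly_stable_def up_move_def by blast

lemma min_gens_in: "a \<in> min_gens J \<Longrightarrow> a \<in> mons_in J"
  by (simp add: min_gens_def)

lemma min_gens_div: "d + b \<in> min_gens J \<Longrightarrow> b \<in> mons_in J \<Longrightarrow> d = 0"
  unfolding min_gens_def by (metis (mono_tags, lifting) add_0 add_right_cancel mem_Collect_eq)

lemma head_in: "snd w \<in> min_gens J \<Longrightarrow> head w \<in> mons_in J"
  by (simp add: head_def mons_in_add min_gens_in)

text \<open>
  The pairs whose product is minimal among those with the same head are those of the
  Eliahou-Kervaire decomposition: no variable of the first factor exceeds one of the second.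
\<close>

definition is_ek :: "'n mon \<times> 'n mon \<Rightarrow> bool" where
  "is_ek w \<longleftrightarrow> snd w \<in> min_gens J \<and> (\<forall>i\<in>keys (fst w). \<forall>j\<in>keys (snd w). i \<le> j)"

lemma is_ek_le: "is_ek w \<Longrightarrow> i \<in> keys (fst w) \<Longrightarrow> j \<in> keys (snd w) \<Longrightarrow> i \<le> j"
  by (simp add: is_ek_def)

text \<open>Suppose a proper divisor of X^b lies in J, so that X^b / X_j is in J for some j \<ge> i.
  If j = i, this is X^b' itself. If j > i, then X_i still divides X^b / X_j, and the up move from
  X_i to X_j turns it into X^b'. Either way X^b' lies in J, a contradiction.\<close>

lemma min_gensI:
  assumes b: "b \<in> mons_in J" "b = b' + var i" "b' \<notin> mons_in J" and i: "\<forall>j\<in>keys b. i \<le> j"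
  shows "b \<in> min_gens J"
  unfolding min_gens_def
proof (intro CollectI conjI ballI impI b(1))
  fix c assume c: "c \<in> mons_in J" and "\<exists>d. b = d + c"
  then obtain d where d: "b = d + c" by blast
  have "d = 0"
  proof (rule ccontr)
    assume "d \<noteq> 0"
    then obtain j where j: "j \<in> keys d" using mon_nonzero_keys by blast
    obtain d' where d': "d = d' + var j" using var_divI[OF j] by blast
    have in_J: "d' + c \<in> mons_in J" by (rule mons_in_add[OF c])
    have "j \<in> keys b" using d d' by auto
    then have "i \<le> j" using i by auto
    show False
    proof (cases "i = j")
      case True
      then have "b' + var i = (d' + c) + var i" using b(2) d d' by (simp add: ac_simps)
      then show False using in_J b(3) by simp
    next
      case False
      then have ij: "i < j" using \<open>i \<le> j\<close> by simp
      have "lookup b i = lookup (d' + c) i" using False d d' by (simp add: lookup_add lookup_single)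
      moreover have "lookup b i > 0" using b(2) by (simp add: lookup_add)
      ultimately have "i \<in> keys (d' + c)" unfolding in_keys_iff by simp
      from var_divI[OF this] obtain e where e: "d' + c = e + var i" by blast
      have "e + var j \<in> mons_in J" using mons_in_up[OF _ ij, of e] in_J e by simp
      moreover have "b' + var i = (e + var j) + var i"
        using b(2) d d' e by (metis add.assoc add.commute)
      ultimately show False using b(3) by simp
    qed
  qed
  then show "c = b" using d by simp
qed

text \<open>Divide by the smallest variable until a minimal generator is left; by
  \<open>min_gensI\<close> the quotient cannot leave J earlier. Each removed variable is at most all
  variables that remain.\<close>

lemma ek_exists: "b \<in> mons_in J \<Longrightarrow> \<exists>w. is_ek w \<and> head w = b"
proof (induction "mdeg b" arbitrary: b rule: less_induct)
  case less
  show ?case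
  proof (cases "b \<in> min_gens J")
    case True
    then show ?thesis by (intro exI[of _ "(0, b)"]) (auto simp: is_ek_def head_def)
  next
    case False
    have "b \<noteq> 0"
    proof
      assume "b = 0"
      then have "b \<in> min_gens J"
        using less.prems mon_zero_minimal by (auto simp: min_gens_def)
      then show False using False by simp
    qed
    then have ne: "keys b \<noteq> {}" by (rule mon_nonzero_keys)
    define i where "i = Min (keys b)"
    have i: "i \<in> keys b" "\<forall>j\<in>keys b. i \<le> j" using ne by (auto simp: i_def)
    obtain b' where b': "b = b' + var i" using var_divI[OF i(1)] by blast
    have "b' \<in> mons_in J" using min_gensI[OF less.prems b' _ i(2)] False by blast
    then obtain w where w: "is_ek w" "head w = b'" using less.hyps[of b'] b' by auto
    have "is_ek (fst w + var i, snd w)"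
      using w i(2) b' by (auto simp: is_ek_def head_def)
    moreover have "head (fst w + var i, snd w) = b"
      using w b' by (auto simp: head_def ac_simps)
    ultimately show ?thesis by blast
  qed
qed

text \<open>The source of termination. Otherwise \<open>fst w\<close> exceeds \<open>d\<close> at
  the largest variable i where they differ. Above i the exponents of \<open>snd w\<close> and
  \<open>c\<close> agree, at i that of \<open>snd w\<close> is smaller, and below i it is 0 because
  X_i divides the cofactor. So \<open>snd w\<close> would divide \<open>c\<close>.\<close>

lemma is_ek_lex_less:
  assumes ek: "is_ek w" and eq: "head w = d + c" and ndiv: "\<And>e. c \<noteq> e + snd w"
  shows "lex_less (fst w) d"
proof (rule ccontr)
  assume "\<not> ?thesis"
  moreover have "fst w \<noteq> d"
    using eq ndiv[of 0] by (auto simp: head_def)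
  ultimately have "lex_less d (fst w)" using lex_less_linear by blast
  then obtain i where i: "lookup d i < lookup (fst w) i" "\<forall>j>i. lookup d j = lookup (fst w) j"
    by (auto simp: lex_less_def)
  have "lookup (snd w) j \<le> lookup c j" for j
  proof -
    have sum: "lookup (fst w) j + lookup (snd w) j = lookup d j + lookup c j"
      using arg_cong[OF eq, of "\<lambda>x. lookup x j"] by (simp add: head_def lookup_add)
    consider "j < i" | "j = i" | "j > i" by fastforce
    then show ?thesis
    proof cases
      case 1
      have "i \<in> keys (fst w)" using i(1) by (simp add: in_keys_iff)
      then have "j \<notin> keys (snd w)" using is_ek_le[OF ek] 1 leD by blast
      then show ?thesis by (simp add: in_keys_iff)
    qed (use sum i in auto)
  qed
  then show False using mon_divI[of "snd w" c] ndiv by blast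
qed

text \<open>\<open>W_gt\<close> looks at the smallest variable i where the cofactors differ,
  \<open>lex_less\<close> at the largest. If \<open>w'\<close> had the larger exponent at i, then
  X_i would divide \<open>snd w\<close>, so \<open>fst w\<close> would have no variable above i, and
  \<open>snd w'\<close> would be a proper divisor of the minimal generator
  \<open>snd w\<close>.\<close>

lemma is_ek_W_gt:
  assumes ek: "is_ek w" and w': "snd w' \<in> min_gens J" "head w' = head w" "w' \<noteq> w"
  shows "W_gt w' w"
proof -
  let ?D = "{i. lookup (fst w) i \<noteq> lookup (fst w') i}"
  have sum: "lookup (fst w) j + lookup (snd w) j = lookup (fst w') j + lookup (snd w') j" for j
    using arg_cong[OF w'(2), of "\<lambda>x. lookup x j"] by (simp add: head_def lookup_add)
  have "fst w \<noteq> fst w'"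
    using w'(2,3) by (metis add_left_cancel head_def prod.expand)
  then have "?D \<noteq> {}" using poly_mapping_eqI[of "fst w" "fst w'"] by blast
  define i where "i = Min ?D"
  have iD: "i \<in> ?D" unfolding i_def by (rule Min_in) (use \<open>?D \<noteq> {}\<close> in auto)
  have below: "lookup (fst w) j = lookup (fst w') j" if "j < i" for j
    using that Min_le[of ?D j] by (auto simp: i_def not_le[symmetric])
  have "\<not> lookup (fst w) i < lookup (fst w') i"
  proof
    assume less: "lookup (fst w) i < lookup (fst w') i"
    then have "i \<in> keys (snd w)" using sum[of i] by (simp add: in_keys_iff)
    then have above: "lookup (fst w) j = 0" if "j > i" for j
      using is_ek_le[OF ek] that by (metis in_keys_iff leD)
    have "lookup (snd w') j \<le> lookup (snd w) j" for j
    proof -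
      consider "j < i" | "j = i" | "j > i" by fastforce
      then show ?thesis by cases (use sum[of j] below[of j] above[of j] less in auto)
    qed
    then obtain e where e: "snd w = e + snd w'" using mon_divI by blast
    then have "e = 0"
      using min_gens_div[of e "snd w'"] ek min_gens_in[OF w'(1)] by (simp add: is_ek_def)
    then show False using e less sum[of i] by simp
  qed
  then show ?thesis
    unfolding W_gt_def using iD below by (intro exI[of _ i]) auto
qed

lemma V_set_iff: "w \<in> V_set J m \<longleftrightarrow> is_ek w \<and> mdeg (head w) = m"
proof
  assume "is_ek w \<and> mdeg (head w) = m"
  then show "w \<in> V_set J m"
    using is_ek_W_gt by (auto simp: V_set_def W_set_def is_ek_def head_in)
next
  assume w: "w \<in> V_set J m"
  then have w': "snd w \<in> min_gens J" "mdeg (head w) = m" by (auto simp: V_set_def W_set_def)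
  obtain v where v: "is_ek v" "head v = head w" using ek_exists[OF head_in[OF w'(1)]] by blast
  have "v = w"
  proof (rule ccontr)
    assume ne: "v \<noteq> w"
    have "W_gt w v" by (rule is_ek_W_gt) (use v w' ne in auto)
    moreover have "v \<in> W_set J m"
      using v w' by (simp add: W_set_def is_ek_def head_in)
    then have "W_gt v w" using w v(2) ne by (simp add: V_set_def)
    ultimately show False
      unfolding W_gt_def by (metis linorder_cases order_less_asym less_irrefl_nat)
  qed
  then show "is_ek w \<and> mdeg (head w) = m" using v w' by simp
qed

lemma is_ek_unique:
  assumes "is_ek v" "is_ek w" "head v = head w"
  shows "v = w"
proof (rule ccontr)
  assume ne: "v \<noteq> w"
  have "W_gt w v" "W_gt v w"
    by (rule is_ek_W_gt; use assms ne in \<open>auto simp: is_ek_def\<close>)+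
  then show False
    unfolding W_gt_def by (metis linorder_cases order_less_asym less_irrefl_nat)
qed

definition ek :: "'n mon \<Rightarrow> 'n mon \<times> 'n mon" where
  "ek b = (SOME w. is_ek w \<and> head w = b)"

lemma is_ek_ek: "b \<in> mons_in J \<Longrightarrow> is_ek (ek b)"
  and head_ek: "b \<in> mons_in J \<Longrightarrow> head (ek b) = b"
  using someI_ex[OF ek_exists] unfolding ek_def by blast+

lemma ek_head: "is_ek w \<Longrightarrow> ek (head w) = w"
  by (meson head_ek head_in is_ek_def is_ek_ek is_ek_unique)

lemma snd_ek_in: "b \<in> mons_in J \<Longrightarrow> snd (ek b) \<in> min_gens J"
  using is_ek_ek by (simp add: is_ek_def)

section \<open>Complete reduction\<close>

definition kC :: "('n cvar, 'k) mpol set" where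
  "kC = {p. \<forall>m\<in>keys p. keys m \<subseteq> C_vars J}"

lemma ring_kC_eq: "ring_kC J = ring_on kC"
  by (simp add: ring_kC_def kC_def)

lemma subring_kC: "subring_set kC"
proof
  show "1 \<in> kC" by (simp add: kC_def)
  show "a - b \<in> kC" if "a \<in> kC" "b \<in> kC" for a b
    using that Poly_Mapping.keys_diff[of a b] unfolding kC_def by blast
  show "a * b \<in> kC" if "a \<in> kC" "b \<in> kC" for a b
    using that keys_mult[of a b] unfolding kC_def by fastforce
qed

interpretation kC: subring_set kC by (rule subring_kC)

lemma C_var_in: "(\<alpha>, \<gamma>) \<in> C_vars J \<Longrightarrow> C_var \<alpha> \<gamma> \<in> kC"
  by (simp add: kC_def C_var_def)

abbreviation outs :: "nat \<Rightarrow> 'n mon set" where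
  "outs m \<equiv> {\<gamma> \<in> mons_out J. mdeg \<gamma> = m}"

lemma C_var_outs_in: "\<alpha> \<in> min_gens J \<Longrightarrow> \<gamma> \<in> outs (mdeg \<alpha>) \<Longrightarrow> C_var \<alpha> \<gamma> \<in> kC"
  by (intro C_var_in) (auto simp: C_vars_def)

lemma tail_eq:
  "tail J w = (\<Sum>\<gamma>\<in>outs (mdeg (snd w)). const (C_var (snd w) \<gamma>) * X_pow (fst w + \<gamma>))"
  by (simp add: tail_def XF_def F_poly_def head_def X_pow_add right_diff_distrib
      sum_distrib_left ac_simps)

lemma keys_tail:
  assumes "b \<in> keys (tail J w)"
  obtains \<gamma> where "\<gamma> \<in> outs (mdeg (snd w))" "b = fst w + \<gamma>"
proof -
  have "keys (tail J w) \<subseteq> (\<Union>\<gamma>\<in>outs (mdeg (snd w)).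
      keys (const (C_var (snd w) \<gamma>) * X_pow (fst w + \<gamma>) :: ('n, ('n cvar, 'k) mpol) mpol))"
    unfolding tail_eq by (rule Poly_Mapping.keys_sum)
  then obtain \<gamma> where \<gamma>: "\<gamma> \<in> outs (mdeg (snd w))"
      "b \<in> keys (const (C_var (snd w) \<gamma>) * X_pow (fst w + \<gamma>) :: ('n, ('n cvar, 'k) mpol) mpol)"
    using assms by blast
  have "b = fst w + \<gamma>" using \<gamma>(2) by (simp add: const_mult_X_pow split: if_splits)
  with \<gamma>(1) show thesis by (rule that)
qed

lemma XF_eq: "XF J w = X_pow (head w) - tail J w"
  by (simp add: tail_def)

lemma X_pow_mult_XF: "X_pow d * XF J w = XF J (d + fst w, snd w)"
  by (simp add: XF_def X_pow_add mult.assoc)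

text \<open>The generator in the decomposition of \<open>d + \<gamma>\<close> cannot divide
  \<gamma>, which is outside J. Applied to a tail, this says that every further reduction uses a
  smaller cofactor.\<close>

lemma ek_lex_less_out:
  assumes "\<gamma> \<in> mons_out J" "d + \<gamma> \<in> mons_in J"
  shows "lex_less (fst (ek (d + \<gamma>))) d"
proof (rule is_ek_lex_less)
  show "is_ek (ek (d + \<gamma>))" "head (ek (d + \<gamma>)) = d + \<gamma>"
    using assms(2) by (auto intro: is_ek_ek head_ek)
  show "\<gamma> \<noteq> e + snd (ek (d + \<gamma>))" for e
    using mons_in_add[OF min_gens_in[OF snd_ek_in[OF assms(2)]], of e] assms(1)
    by (auto simp: mons_out_iff)
qed

lemma mdeg_ek: "b \<in> mons_in J \<Longrightarrow> mdeg (fst (ek b)) + mdeg (snd (ek b)) = mdeg b"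
  using head_ek[of b] by (metis head_def mdeg_add)

text \<open>The \<open>Suc\<close> places every monomial of J above those outside, which are already
  reduced. Taking \<open>mdeg b\<close> as the bound is consistent because reduction preserves the
  degree.\<close>

definition rank :: "'n mon \<Rightarrow> nat" where
  "rank b = (if b \<in> mons_in J then Suc (lex_rank (mdeg b) (fst (ek b))) else 0)"

lemma rank_less:
  assumes b: "b \<in> mons_in J" and \<gamma>: "\<gamma> \<in> outs (mdeg (snd (ek b)))"
  shows "rank (fst (ek b) + \<gamma>) < rank b"
proof (cases "fst (ek b) + \<gamma> \<in> mons_in J")
  case True
  have deg: "mdeg (fst (ek b) + \<gamma>) = mdeg b" using \<gamma> mdeg_ek[OF b] by simp
  have "lex_less (fst (ek (fst (ek b) + \<gamma>))) (fst (ek b))"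
    using \<gamma> True by (intro ek_lex_less_out) auto
  moreover have "mdeg (fst (ek (fst (ek b) + \<gamma>))) \<le> mdeg b"
    using mdeg_ek[OF True] deg by simp
  ultimately show ?thesis
    using b True deg by (simp add: rank_def lex_rank_less)
qed (simp add: rank_def b)

text \<open>Each monomial of J has exactly one admissible reducer, so its normal form is given by a
  recursion on monomials, and no choice of a reduction strategy enters.\<close>

function nf :: "'n mon \<Rightarrow> ('n, ('n cvar, 'k) mpol) mpol" where
  "nf b = (if b \<in> mons_in J
     then \<Sum>\<gamma>\<in>outs (mdeg (snd (ek b))). const (C_var (snd (ek b)) \<gamma>) * nf (fst (ek b) + \<gamma>)
     else X_pow b)"
  by auto
termination
  by (relation "measure rank") (use rank_less in auto)

declare nf.simps [simp del]

lemma nf_out: "b \<in> mons_out J \<Longrightarrow> nf b = X_pow b"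
  by (simp add: nf.simps mons_out_iff)

lemma nf_in: "b \<in> mons_in J \<Longrightarrow>
    nf b = (\<Sum>\<gamma>\<in>outs (mdeg (snd (ek b))). const (C_var (snd (ek b)) \<gamma>) * nf (fst (ek b) + \<gamma>))"
  by (simp add: nf.simps)

abbreviation NF :: "('n, ('n cvar, 'k) mpol) mpol \<Rightarrow> ('n, ('n cvar, 'k) mpol) mpol" where
  "NF \<equiv> lin_ext nf"

lemma keys_nf: "keys (nf b) \<subseteq> outs (mdeg b)"
proof (induction b rule: nf.induct)
  case (1 b)
  show ?case
  proof (cases "b \<in> mons_in J")
    case True
    have "keys (const (C_var (snd (ek b)) \<gamma>) * nf (fst (ek b) + \<gamma>)) \<subseteq> outs (mdeg b)"
      if "\<gamma> \<in> outs (mdeg (snd (ek b)))" for \<gamma>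
      using keys_const_mult 1[OF True that] that mdeg_ek[OF True] by fastforce
    then show ?thesis
      unfolding nf_in[OF True] using Poly_Mapping.keys_sum by fast
  qed (simp add: nf.simps mons_out_iff)
qed

lemma lookup_nf_in: "lookup (nf b) g \<in> kC"
proof (induction b rule: nf.induct)
  case (1 b)
  show ?case
  proof (cases "b \<in> mons_in J")
    case True
    then show ?thesis
      unfolding nf_in[OF True] lookup_sum lookup_const_mult
      by (intro kC.sum_closed kC.mult_closed 1[OF True] C_var_outs_in snd_ek_in)
  next
    case False
    then show ?thesis
      by (simp add: nf_out mons_out_iff lookup_X_pow kC.one_closed kC.zero_closed)
  qed
qed

lemma keys_NF: "keys (NF h) \<subseteq> mons_out J"
proof
  fix g assume "g \<in> keys (NF h)"
  then have "(\<Sum>m\<in>keys h. lookup h m * lookup (nf m) g) \<noteq> 0"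
    by (simp add: in_keys_iff lookup_lin_ext)
  then obtain m where "lookup h m * lookup (nf m) g \<noteq> 0" by (meson sum.neutral)
  then have "g \<in> keys (nf m)" by (auto simp: in_keys_iff)
  then show "g \<in> mons_out J" using keys_nf by blast
qed

lemma NF_id: "keys h \<subseteq> mons_out J \<Longrightarrow> NF h = h"
proof -
  assume h: "keys h \<subseteq> mons_out J"
  have "NF h = (\<Sum>m\<in>keys h. Poly_Mapping.single m (lookup h m))"
    unfolding lin_ext_def by (rule sum.cong) (use h in \<open>auto simp: nf_out const_mult_X_pow\<close>)
  then show ?thesis by (simp flip: sum_singles)
qed

lemma NF_XF: "is_ek w \<Longrightarrow> NF (XF J w) = 0"
  using nf_in[of "head w"]
  by (simp add: XF_eq lin_ext_diff tail_eq lin_ext_sum lin_ext_const_mult ek_head is_ek_def head_in)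

lemma NF_coeffs_in_ideal:
  assumes I: "ideal I (ring_kC J)" and h: "\<And>g. lookup h g \<in> I"
  shows "lookup (NF h) g \<in> I"
  unfolding lookup_lin_ext
  by (intro ideal_on_sum[OF subring_kC] ideal_on_mult_right[OF subring_kC] lookup_nf_in h
      I[unfolded ring_kC_eq])

text \<open>Only coefficients from k[C] are allowed, no further factors in X: the index set
  \<open>Q\<close> has to record all cofactors, since these are what the lexicographic arguments
  bound.\<close>

inductive_set XF_span :: "('n mon \<times> 'n mon) set \<Rightarrow> ('n, ('n cvar, 'k) mpol) mpol set"
  for Q where
  zero: "0 \<in> XF_span Q"
| step: "h \<in> XF_span Q \<Longrightarrow> t \<in> kC \<Longrightarrow> w \<in> Q \<Longrightarrow> h + const t * XF J w \<in> XF_span Q"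

lemma XF_span_self: "w \<in> Q \<Longrightarrow> XF J w \<in> XF_span Q"
  using XF_span.step[OF XF_span.zero kC.one_closed] by simp

lemma XF_span_add:
  assumes "p \<in> XF_span Q" "q \<in> XF_span Q"
  shows "p + q \<in> XF_span Q"
  using assms(2,1)
proof (induction q rule: XF_span.induct)
  case (step h t w)
  then show ?case using XF_span.step[of "p + h" Q t w] by (simp add: add.assoc)
qed simp

lemma XF_span_const_mult:
  assumes "c \<in> kC" "p \<in> XF_span Q"
  shows "const c * p \<in> XF_span Q"
  using assms(2,1)
proof (induction p rule: XF_span.induct)
  case (step h t w)
  then show ?case
    using XF_span.step[of "const c * h" Q "c * t" w]
    by (simp add: distrib_left const_mult mult.assoc kC.mult_closed)
qed (simp add: XF_span.zero)

lemma XF_span_uminus: "p \<in> XF_span Q \<Longrightarrow> - p \<in> XF_span Q"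
  using XF_span_const_mult[of "- 1" p] by (simp add: const_uminus kC.uminus_closed kC.one_closed)

lemma XF_span_diff: "p \<in> XF_span Q \<Longrightarrow> q \<in> XF_span Q \<Longrightarrow> p - q \<in> XF_span Q"
  using XF_span_add[of p Q "- q"] XF_span_uminus by simp

lemma XF_span_sum: "(\<And>a. a \<in> A \<Longrightarrow> f a \<in> XF_span Q) \<Longrightarrow> sum f A \<in> XF_span Q"
  by (induction A rule: infinite_finite_induct) (auto intro: XF_span.zero XF_span_add)

lemma XF_span_mono: "p \<in> XF_span Q \<Longrightarrow> Q \<subseteq> Q' \<Longrightarrow> p \<in> XF_span Q'"
  by (induction p rule: XF_span.induct) (auto intro: XF_span.intros)

abbreviation eks :: "nat \<Rightarrow> ('n mon \<times> 'n mon) set" where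
  "eks m \<equiv> {w. is_ek w \<and> mdeg (head w) = m}"

text \<open>Unfolding one step of \<open>nf\<close> contributes the product \<open>ek b\<close>; the
  rest comes from its tail, where cofactors are strictly smaller. The bound on cofactors is needed
  later, when such a combination is multiplied by a monomial.\<close>

lemma nf_span_le:
  "b \<in> mons_in J \<Longrightarrow> X_pow b - nf b
     \<in> XF_span {w \<in> eks (mdeg b). fst w = fst (ek b) \<or> lex_less (fst w) (fst (ek b))}"
proof (induction b rule: nf.induct)
  case (1 b)
  note b = \<open>b \<in> mons_in J\<close>
  let ?Q = "\<lambda>b. {w \<in> eks (mdeg b). fst w = fst (ek b) \<or> lex_less (fst w) (fst (ek b))}"
  let ?d = "fst (ek b)" and ?a = "snd (ek b)"
  have "X_pow b - nf b
      = XF J (ek b) + (\<Sum>\<gamma>\<in>outs (mdeg ?a). const (C_var ?a \<gamma>) * (X_pow (?d + \<gamma>) - nf (?d + \<gamma>)))"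
    by (simp add: XF_eq head_ek[OF b] nf_in[OF b] tail_eq right_diff_distrib sum_subtractf)
  also have "\<dots> \<in> XF_span (?Q b)"
  proof (intro XF_span_add XF_span_sum XF_span_const_mult)
    show "XF J (ek b) \<in> XF_span (?Q b)"
      by (rule XF_span_self) (use b is_ek_ek head_ek in auto)
    fix \<gamma> assume \<gamma>: "\<gamma> \<in> outs (mdeg ?a)"
    show "C_var ?a \<gamma> \<in> kC" using C_var_outs_in[OF snd_ek_in[OF b] \<gamma>] .
    show "X_pow (?d + \<gamma>) - nf (?d + \<gamma>) \<in> XF_span (?Q b)"
    proof (cases "?d + \<gamma> \<in> mons_in J")
      case True
      have lex: "lex_less (fst (ek (?d + \<gamma>))) ?d"
        using ek_lex_less_out[OF _ True] \<gamma> by simp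
      have "?Q (?d + \<gamma>) \<subseteq> ?Q b"
        using lex lex_less_trans[OF _ lex] mdeg_ek[OF b] \<gamma> by auto
      then show ?thesis using XF_span_mono[OF 1(1)[OF b \<gamma> True]] by blast
    qed (simp add: nf.simps XF_span.zero)
  qed
  finally show ?case .
qed

lemma nf_span_less:
  assumes "\<gamma> \<in> mons_out J"
  shows "X_pow (d + \<gamma>) - nf (d + \<gamma>) \<in> XF_span {w \<in> eks (mdeg (d + \<gamma>)). lex_less (fst w) d}"
proof (cases "d + \<gamma> \<in> mons_in J")
  case True
  note lex = ek_lex_less_out[OF assms True]
  show ?thesis
    by (rule XF_span_mono[OF nf_span_le[OF True]]) (use lex lex_less_trans[OF _ lex] in auto)
qed (simp add: nf.simps XF_span.zero)

lemma nf_span: "X_pow b - nf b \<in> XF_span (eks (mdeg b))"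
proof (cases "b \<in> mons_in J")
  case True
  then show ?thesis by (rule XF_span_mono[OF nf_span_le]) auto
qed (simp add: nf.simps XF_span.zero)

lemma minus_NF: "h - NF h = (\<Sum>m\<in>keys h. const (lookup h m) * (X_pow m - nf m))"
  by (subst (1) sum_singles[of h])
    (simp add: lin_ext_def right_diff_distrib sum_subtractf const_mult_X_pow)

lemma NF_span:
  assumes "\<And>g. lookup h g \<in> kC" "\<And>g. g \<in> keys h \<Longrightarrow> mdeg g = m"
  shows "h - NF h \<in> XF_span (eks m)"
  unfolding minus_NF using nf_span assms by (intro XF_span_sum XF_span_const_mult) auto

section \<open>Termination and uniqueness of complete reduction\<close>

lemma red_step_NF: "red_step J h h' \<Longrightarrow> NF h' = NF h"
proof -
  assume "red_step J h h'"
  then obtain m w where w: "w \<in> V_set J m"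
    and h': "h' = h - const (lookup h (head w)) * X_pow (head w)
      + const (lookup h (head w)) * tail J w"
    unfolding red_step_def by blast
  have "h' = h - const (lookup h (head w)) * XF J w"
    by (simp add: h' XF_eq algebra_simps)
  then show ?thesis
    using w by (simp add: lin_ext_diff lin_ext_const_mult NF_XF V_set_iff)
qed

lemma keys_tail_rank:
  assumes w: "is_ek w" and b: "b \<in> keys (tail J w)"
  shows "rank b < rank (head w)"
proof -
  obtain \<gamma> where \<gamma>: "\<gamma> \<in> outs (mdeg (snd w))" "b = fst w + \<gamma>" using b by (rule keys_tail)
  then show ?thesis
    using rank_less[OF head_in, of w \<gamma>] w ek_head[OF w] by (simp add: is_ek_def)
qed

text \<open>A step removes one monomial of J and may bring in several others, all of smaller rank;
  hence the multiset order on the monomials of J that occur.\<close>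

lemma red_exists: "\<exists>g. (red_step J)\<^sup>*\<^sup>* h g \<and> keys g \<subseteq> mons_out J"
proof -
  define ms where "ms h = mset_set (keys h \<inter> mons_in J)"
    for h :: "('n, ('n cvar, 'k) mpol) mpol"
  have "wf (inv_image (mult (measure rank)) ms)" by (intro wf_inv_image wf_mult wf_measure)
  then show ?thesis
  proof (induction h rule: wf_induct_rule)
    case (less h)
    show ?case
    proof (cases "keys h \<subseteq> mons_out J")
      case False
      then obtain b where b: "b \<in> keys h" "b \<in> mons_in J" by (auto simp: mons_out_iff)
      let ?w = "ek b" and ?c = "lookup h b"
      define h' where "h' = h - const ?c * X_pow b + const ?c * tail J ?w"
      note ek = is_ek_ek[OF b(2)] and head = head_ek[OF b(2)]
      have step: "red_step J h h'"
        unfolding red_step_def h'_def using ek head b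
        by (intro exI[of _ "mdeg b"] bexI[of _ ?w]) (auto simp: V_set_iff)
      \<comment> \<open>The head does not occur in its own tail, so \<open>b\<close> really
        disappears and every new monomial stems from the tail.\<close>
      have small: "rank d < rank b" if "d \<in> keys h'" "d \<notin> keys h - {b}" for d
      proof -
        have "lookup (tail J ?w) b = 0"
          using keys_tail_rank[OF ek, of b] head by (auto simp: in_keys_iff)
        then have "d \<in> keys (tail J ?w)"
          using that by (auto simp: h'_def in_keys_iff lookup_add lookup_minus lookup_X_pow
              split: if_splits)
        then show ?thesis using keys_tail_rank[OF ek] head by simp
      qed
      \<comment> \<open>The monomials of J that survive the step; the multiset comparison concerns
        only what lies outside this common part.\<close>
      define I where "I = (keys h - {b}) \<inter> keys h' \<inter> mons_in J"
      have split: "ms p = mset_set I + mset_set (keys p \<inter> mons_in J - I)"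
        if "I \<subseteq> keys p \<inter> mons_in J" for p
      proof -
        have "keys p \<inter> mons_in J = I \<union> (keys p \<inter> mons_in J - I)" using that by blast
        moreover have "finite I" by (simp add: I_def)
        ultimately show ?thesis unfolding ms_def
          by (metis Diff_disjoint finite_Diff finite_Int finite_keys mset_set_Union)
      qed
      have "(ms h', ms h) \<in> mult (measure rank)"
      proof -
        have "(mset_set I + mset_set (keys h' \<inter> mons_in J - I),
               mset_set I + mset_set (keys h \<inter> mons_in J - I)) \<in> mult (measure rank)"
        proof (rule one_step_implies_mult)
          have bI: "b \<in># mset_set (keys h \<inter> mons_in J - I)" using b by (simp add: I_def)
          then show "mset_set (keys h \<inter> mons_in J - I) \<noteq> {#}" by fastforce
          show "\<forall>d\<in>#mset_set (keys h' \<inter> mons_in J - I).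
              \<exists>j\<in>#mset_set (keys h \<inter> mons_in J - I). (d, j) \<in> measure rank"
            using bI small by (intro ballI bexI[of _ b]) (auto simp: I_def)
        qed
        then show ?thesis using split[of h] split[of h'] by (simp add: I_def inf.coboundedI1)
      qed
      then obtain g where "(red_step J)\<^sup>*\<^sup>* h' g" "keys g \<subseteq> mons_out J"
        using less[of h'] by auto
      then show ?thesis using step by (meson converse_rtranclp_into_rtranclp)
    qed blast
  qed
qed

text \<open>Steps subtract multiples of minimal products, on which \<open>NF\<close> vanishes, so
  \<open>NF\<close> is invariant along a reduction; on a completely reduced polynomial it is the
  identity.\<close>

lemma complete_red_eq: "complete_red J h = NF h"
proof -
  have "g = NF h" if "(red_step J)\<^sup>*\<^sup>* h g" "keys g \<subseteq> mons_out J" for g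
  proof -
    have "NF g = NF h" using that(1) by induction (auto simp: red_step_NF)
    then show ?thesis using NF_id[OF that(2)] by simp
  qed
  then show ?thesis
    unfolding complete_red_def using red_exists[of h] by (intro the_equality) blast+
qed

section \<open>Reduction of S-polynomials\<close>

lemma lookup_XF_in: "snd w \<in> min_gens J \<Longrightarrow> lookup (XF J w) g \<in> kC"
  unfolding XF_eq tail_eq lookup_minus lookup_sum lookup_const_mult lookup_X_pow
  by (intro kC.diff_closed kC.sum_closed kC.mult_closed C_var_outs_in)
    (auto simp: kC.one_closed kC.zero_closed)

lemma keys_XF: "g \<in> keys (XF J w) \<Longrightarrow> mdeg g = mdeg (head w)"
proof -
  assume g: "g \<in> keys (XF J w)"
  have "mdeg a = mdeg (head w)" if "a \<in> keys (tail J w)" for a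
    by (rule keys_tail[OF that]) (simp add: head_def)
  moreover have "keys (XF J w) \<subseteq> {head w} \<union> keys (tail J w)"
    unfolding XF_eq using Poly_Mapping.keys_diff[of "X_pow (head w)" "tail J w"] by simp
  ultimately show ?thesis using g by blast
qed

lemma lookup_NF_in:
  assumes "\<And>g. lookup h g \<in> kC"
  shows "lookup (NF h) g \<in> kC"
  unfolding lookup_lin_ext by (intro kC.sum_closed kC.mult_closed assms lookup_nf_in)

text \<open>The pair \<open>w\<close> may be any product here, minimal or not: the descent of
  cofactors depends only on the tail monomials being multiples of monomials outside J.\<close>

lemma tail_minus_NF:
  assumes "snd w \<in> min_gens J"
  shows "tail J w - NF (tail J w) \<in> XF_span {u \<in> eks (mdeg (head w)). lex_less (fst u) (fst w)}"
proof -
  have "tail J w - NF (tail J w) = (\<Sum>\<gamma>\<in>outs (mdeg (snd w)).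
      const (C_var (snd w) \<gamma>) * (X_pow (fst w + \<gamma>) - nf (fst w + \<gamma>)))"
    by (simp add: tail_eq lin_ext_sum lin_ext_const_mult right_diff_distrib sum_subtractf)
  also have "\<dots> \<in> XF_span {u \<in> eks (mdeg (head w)). lex_less (fst u) (fst w)}"
  proof (intro XF_span_sum XF_span_const_mult C_var_outs_in assms)
    fix \<gamma> assume \<gamma>: "\<gamma> \<in> outs (mdeg (snd w))"
    then show "X_pow (fst w + \<gamma>) - nf (fst w + \<gamma>)
        \<in> XF_span {u \<in> eks (mdeg (head w)). lex_less (fst u) (fst w)}"
      using nf_span_less[of \<gamma> "fst w"] by (simp add: head_def)
  qed
  finally show ?thesis .
qed

lemma X_pow_mult_XF_span:
  assumes I: "ideal I (ring_kC J)"
    and Q: "\<And>u g. u \<in> Q \<Longrightarrow> lookup (NF (XF J (d + fst u, snd u))) g \<in> I"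
    and p: "p \<in> XF_span Q"
  shows "lookup (NF (X_pow d * p)) g \<in> I"
proof -
  note I' = I[unfolded ring_kC_eq]
  show ?thesis
    using p
  proof (induction p rule: XF_span.induct)
    case zero
    then show ?case by (simp add: ideal_on_zero[OF subring_kC I'])
  next
    case (step h t w)
    have "X_pow d * (h + const t * XF J w) = X_pow d * h + const t * XF J (d + fst w, snd w)"
      using X_pow_mult_XF[of d w] by (simp add: distrib_left mult.left_commute[of "X_pow d"])
    then show ?case
      using step Q
      by (auto simp: lin_ext_add lin_ext_const_mult lookup_add
          intro!: ideal_on_add[OF subring_kC I'] ideal_on_mult[OF subring_kC I'])
  qed
qed

lemma ek_S_pair:
  assumes \<alpha>: "\<alpha> \<in> min_gens J" and v: "is_ek v" "head v = var i + \<alpha>" and ne: "snd v \<noteq> \<alpha>"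
  shows "(v, (var i, \<alpha>)) \<in> S_pairs J" "lex_less (fst v) (var i)"
proof -
  have v_in: "snd v \<in> min_gens J" using v(1) by (simp add: is_ek_def)
  have ndiv: "\<alpha> \<noteq> e + snd v" for e
  proof
    assume e: "\<alpha> = e + snd v"
    then have "e = 0" using min_gens_div[of e "snd v"] \<alpha> min_gens_in[OF v_in] by simp
    then show False using e ne by simp
  qed
  show "lex_less (fst v) (var i)" using is_ek_lex_less[OF v ndiv] .
  have sum: "lookup (fst v) l + lookup (snd v) l = lookup (var i) l + lookup \<alpha> l" for l
    using arg_cong[OF v(2), of "\<lambda>x. lookup x l"] by (simp add: head_def lookup_add)
  obtain l where l: "lookup (snd v) l > lookup \<alpha> l"
    using mon_divI[of "snd v" \<alpha>] ndiv by (meson not_le)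
  then have "l = i" using sum[of l] by (cases "l = i") (auto simp: lookup_single)
  have "lookup (head v) j = max (lookup (snd v) j) (lookup \<alpha> j)" for j
    using sum[of j] l \<open>l = i\<close> by (cases "j = i") (auto simp: head_def lookup_add lookup_single)
  then show "(v, (var i, \<alpha>)) \<in> S_pairs J"
    using v_in \<alpha> v(2) by (simp add: S_pairs_def) (simp add: head_def)
qed

text \<open>
  If \<open>X\<^sub>i\<close> is a variable for which \<open>X\<^sub>i F\<^sub>\<alpha>\<close> is not a minimal product, then modulo \<open>I\<close> it is a
  combination of minimal products \<open>X\<^sup>\<epsilon> F\<^sub>\<beta>\<close> with \<open>\<epsilon>\<close> lexicographically smaller than \<open>X\<^sub>i\<close>.
  Multiplying by the remaining factor of \<open>X\<^sup>\<delta>\<close> gives an induction on \<open>\<delta>\<close>.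
\<close>

lemma NF_XF_in_ideal:
  assumes I: "ideal I (ring_kC J)"
    and S: "\<And>v w g. (v, w) \<in> S_pairs J \<Longrightarrow> v \<in> V_set J (mdeg (head v)) \<Longrightarrow>
              lookup (NF (XF J v - XF J w)) g \<in> I"
    and w: "snd w \<in> min_gens J"
  shows "lookup (NF (XF J w)) g \<in> I"
proof -
  note I' = I[unfolded ring_kC_eq]
  define m where "m = mdeg (head w)"
  have "mdeg (head w) = m" by (simp add: m_def)
  then show ?thesis
    using w
  proof (induction "lex_rank m (fst w)" arbitrary: w g rule: less_induct)
    case less
    note \<alpha> = \<open>snd w \<in> min_gens J\<close>
    show ?case
    proof (cases "is_ek w")
      case True
      then show ?thesis by (simp add: NF_XF ideal_on_zero[OF subring_kC I'])
    next
      case False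
      then obtain i j where ij: "i \<in> keys (fst w)" "j \<in> keys (snd w)" "j < i"
        using \<alpha> by (auto simp: is_ek_def not_le)
      obtain d where d: "fst w = d + var i" using var_divI[OF ij(1)] by blast
      have b: "var i + snd w \<in> mons_in J" by (rule mons_in_add[OF min_gens_in[OF \<alpha>]])
      define v where "v = ek (var i + snd w)"
      have v: "is_ek v" "head v = var i + snd w"
        using is_ek_ek[OF b] head_ek[OF b] by (auto simp: v_def)
      have v_in: "snd v \<in> min_gens J" using v(1) by (simp add: is_ek_def)
      have ne: "snd v \<noteq> snd w"
      proof
        assume eq: "snd v = snd w"
        then have "fst v = var i" using v(2) by (simp add: head_def)
        then show False using is_ek_le[OF v(1), of i j] ij eq by simp
      qed
      note SP = ek_S_pair(1)[OF \<alpha> v ne] and lex = ek_S_pair(2)[OF \<alpha> v ne]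
      define h where "h = XF J v - XF J (var i, snd w)"
      define Q where "Q = {u \<in> eks (mdeg (head v)). lex_less (fst u) (var i)}"
      have deg: "mdeg d + mdeg (head v) = m"
      proof -
        have "mdeg (head v) = 1 + mdeg (snd w)" by (simp add: v(2))
        moreover have "mdeg (head w) = mdeg d + 1 + mdeg (snd w)" by (simp add: head_def d)
        ultimately show ?thesis using less.prems(1) by simp
      qed
      \<comment> \<open>Multiplication by X^d preserves the lexicographic order, so cofactors below
        X_i give cofactors below X^d X_i, which is that of \<open>w\<close>.\<close>
      have IH: "lookup (NF (XF J (d + fst u, snd u))) g \<in> I"
        if u: "lex_less (fst u) (var i)" "snd u \<in> min_gens J" "mdeg (head u) = mdeg (head v)"
        for u g
      proof (rule less.hyps)
        have "mdeg (d + fst u) \<le> m" using deg u(3) by (simp add: head_def)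
        then show "lex_rank m (fst (d + fst u, snd u)) < lex_rank m (fst w)"
          using u(1) by (simp add: d lex_rank_less lex_less_add)
        show "mdeg (head (d + fst u, snd u)) = m" using deg u(3) by (simp add: head_def)
        show "snd (d + fst u, snd u) \<in> min_gens J" using u(2) by simp
      qed
      have "h - NF h \<in> XF_span Q"
      proof -
        \<comment> \<open>The heads cancel, and reducing the two tails uses only cofactors below
          X_i.\<close>
        have "h = tail J (var i, snd w) - tail J v"
          by (simp add: h_def XF_eq v(2)) (simp add: head_def)
        then have "h - NF h = (tail J (var i, snd w) - NF (tail J (var i, snd w)))
            - (tail J v - NF (tail J v))"
          by (simp add: lin_ext_diff)
        also have "\<dots> \<in> XF_span Q"
        proof (rule XF_span_diff)
          have "head (var i, snd w) = head v" using v(2) by (simp add: head_def)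
          then show "tail J (var i, snd w) - NF (tail J (var i, snd w)) \<in> XF_span Q"
            using tail_minus_NF[of "(var i, snd w)"] \<alpha> by (simp add: Q_def)
          show "tail J v - NF (tail J v) \<in> XF_span Q"
            by (rule XF_span_mono[OF tail_minus_NF[OF v_in]])
              (use lex_less_trans[OF _ lex] in \<open>auto simp: Q_def\<close>)
        qed
        finally show ?thesis .
      qed
      then have "lookup (NF (X_pow d * (h - NF h))) g \<in> I" for g
        by (rule X_pow_mult_XF_span[OF I, rotated]) (auto simp: Q_def is_ek_def intro!: IH)
      moreover have "lookup (NF (X_pow d * NF h)) g \<in> I" for g
      proof (rule NF_coeffs_in_ideal[OF I])
        fix g
        have "lookup (NF h) b \<in> I" for b
          unfolding h_def by (rule S[OF SP]) (simp add: V_set_iff v)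
        then show "lookup (X_pow d * NF h) g \<in> I"
          by (cases "\<exists>b. g = d + b")
            (auto simp: X_pow_def lookup_single_mult lookup_single_mult_outside
              ideal_on_zero[OF subring_kC I'])
      qed
      moreover have "lookup (NF (XF J (d + fst v, snd v))) g \<in> I" for g
        by (rule IH) (use lex v_in in auto)
      \<comment> \<open>X^d h is split along h = (h - \<open>NF h\<close>) + \<open>NF h\<close>:
        the first part is covered by induction, the second has coefficients in \<open>I\<close> by
        the hypothesis on S-polynomials.\<close>
      moreover have "XF J w = XF J (d + fst v, snd v) - X_pow d * (h - NF h) - X_pow d * NF h"
      proof -
        have "XF J w = X_pow d * XF J (var i, snd w)"
          by (simp only: X_pow_mult_XF fst_conv snd_conv d[symmetric] prod.collapse)
        then show ?thesis
          by (simp add: h_def X_pow_mult_XF[symmetric] algebra_simps)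
      qed
      ultimately show ?thesis
        by (simp only: lin_ext_diff lookup_minus ideal_on_diff[OF subring_kC I'])
    qed
  qed
qed

section \<open>Minors\<close>

abbreviation ins :: "nat \<Rightarrow> 'n mon set" where
  "ins m \<equiv> {b \<in> mons_in J. mdeg b = m}"

lemma vdim_deg_part: "vdim (deg_part m J) = card (ins m)"
proof -
  interpret vector_space "\<lambda>c f. const c * f :: ('n, 'k) mpol"
    by unfold_locales (auto simp: algebra_simps const_add const_mult)
  let ?B = "X_pow ` ins m :: ('n, 'k) mpol set"
  have inj: "inj_on X_pow A" for A :: "'n mon set"
    by (rule inj_onI) (metis keys_X_pow singleton_inject zero_neq_one)
  have "dim (deg_part m J) = card (ins m)"
  proof (rule dim_unique)
    show "?B \<subseteq> deg_part m J" by (auto simp: deg_part_def mons_in_def)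
    show "card ?B = card (ins m)" by (rule card_image[OF inj])
    show "deg_part m J \<subseteq> span ?B"
    proof
      fix f assume f: "f \<in> deg_part m J"
      then have "keys f \<subseteq> ins m" using in_J_iff by (auto simp: deg_part_def)
      then have "(\<Sum>b\<in>keys f. const (lookup f b) * X_pow b) \<in> span ?B"
        by (intro span_sum span_scale span_base) auto
      then show "f \<in> span ?B" by (simp add: const_mult_X_pow flip: sum_singles)
    qed
    show "independent ?B"
    proof
      assume "dependent ?B"
      then obtain u b where u: "b \<in> ins m" "u (X_pow b) \<noteq> 0" "(\<Sum>v\<in>?B. const (u v) * v) = 0"
        by (subst (asm) dependent_finite) auto
      have "lookup (\<Sum>v\<in>?B. const (u v) * v) b = (\<Sum>a\<in>ins m. if a = b then u (X_pow a) else 0)"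
        by (simp add: sum.reindex[OF inj] lookup_sum lookup_X_pow if_distrib cong: if_cong)
      then show False using u by simp
    qed
  qed
  then show ?thesis by (simp add: vdim_def)
qed

text \<open>Minimal products are determined by their heads, so the coefficients can be indexed by
  the monomials of J_m. This gives the matrices below their size.\<close>

lemma XF_span_coeffs:
  assumes "h \<in> XF_span (eks m)"
  shows "\<exists>t. (\<forall>b. t b \<in> kC) \<and> h = (\<Sum>b\<in>ins m. const (t b) * XF J (ek b))"
  using assms
proof (induction h rule: XF_span.induct)
  case zero
  then show ?case by (intro exI[of _ "\<lambda>_. 0"]) (simp add: kC.zero_closed)
next
  case (step h c w)
  then obtain t where t: "\<And>b. t b \<in> kC" "h = (\<Sum>b\<in>ins m. const (t b) * XF J (ek b))" by blast
  let ?t = "\<lambda>b. t b + (if b = head w then c else 0)"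
  have w: "ek (head w) = w" "head w \<in> ins m"
    using step.hyps by (auto simp: ek_head is_ek_def head_in)
  have "(\<Sum>b\<in>ins m. const (?t b) * XF J (ek b))
      = h + (\<Sum>b\<in>ins m. if b = head w then const c * XF J (ek b) else 0)"
    unfolding t(2) sum.distrib[symmetric]
    by (rule sum.cong) (auto simp: const_add distrib_right)
  then have "h + const c * XF J w = (\<Sum>b\<in>ins m. const (?t b) * XF J (ek b))"
    using w by simp
  moreover have "?t b \<in> kC" for b
    using t(1) step.hyps(2) kC.add_closed kC.zero_closed by auto
  ultimately show ?case by (intro exI[of _ ?t]) blast
qed

lemma lookup_XF_span_coeffs:
  assumes h: "h = (\<Sum>b\<in>ins m. const (t b) * XF J (ek b))"
    and bs: "distinct bs" "set bs = ins m" "length bs = d"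
  shows "lookup h g = (\<Sum>l = 0..<d. t (bs ! l) * lookup (XF J (ek (bs ! l))) g)"
proof -
  have "bij_betw ((!) bs) {0..<d} (ins m)"
    using bij_betw_nth[OF bs(1)] bs(2,3) by (simp add: atLeast0LessThan)
  then show ?thesis
    by (simp add: h lookup_sum sum.reindex_bij_betw[symmetric])
qed

lemma obtain_ins_list:
  obtains bs where "distinct bs" "set bs = ins m" "length bs = card (ins m)"
proof -
  have "finite (ins m)" by simp
  then obtain bs where "set bs = ins m" "distinct bs" using finite_distinct_list by blast
  then show thesis using that[of bs] distinct_card[of bs] by simp
qed

lemma A_rows_iff: "w \<in> A_rows J m \<longleftrightarrow> snd w \<in> min_gens J \<and> mdeg (head w) = m"
  by (auto simp: A_rows_def head_def split: prod.splits)

lemma A_minors_subset: "A_minors J m r \<subseteq> kC"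
proof
  fix x assume "x \<in> A_minors J m r"
  then obtain rs cs where x: "x = det (mat r r (\<lambda>(i, j). lookup (XF J (rs ! i)) (cs ! j)))"
    "set rs \<subseteq> A_rows J m" "length rs = r"
    by (auto simp: A_minors_def)
  have "lookup (XF J (rs ! i)) g \<in> kC" if "i < r" for i g
  proof (rule lookup_XF_in)
    have "rs ! i \<in> A_rows J m" using x(2,3) that by auto
    then show "snd (rs ! i) \<in> min_gens J" by (simp add: A_rows_iff)
  qed
  then show "x \<in> kC" unfolding x(1) by (intro kC.det_closed[where n = r]) auto
qed

lemma ideal_A_eq: "ideal_A J = Idl\<^bsub>ring_on kC\<^esub> (\<Union>m. A_minors J m (Suc (card (ins m))))"
  by (simp add: ideal_A_def vdim_deg_part ring_kC_eq)

lemma ideal_ideal_A: "ideal (ideal_A J) (ring_on kC)"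
  unfolding ideal_A_eq by (rule ideal_genideal_on[OF subring_kC]) (use A_minors_subset in blast)

lemma A_minor_in_ideal_A:
  assumes "distinct rs" "length rs = Suc (card (ins m))" "set rs \<subseteq> A_rows J m"
    and "distinct cs" "length cs = Suc (card (ins m))" "set cs \<subseteq> {\<gamma>. mdeg \<gamma> = m}"
    and "r = Suc (card (ins m))"
  shows "det (mat r r (\<lambda>(i, j). lookup (XF J (rs ! i)) (cs ! j))) \<in> ideal_A J"
proof -
  have "det (mat r r (\<lambda>(i, j). lookup (XF J (rs ! i)) (cs ! j))) \<in> A_minors J m r"
    unfolding A_minors_def using assms by blast
  moreover have "(\<Union>m. A_minors J m (Suc (card (ins m)))) \<subseteq> ideal_A J"
    unfolding ideal_A_eq by (rule genideal_on_self[OF subring_kC]) (use A_minors_subset in blast)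
  ultimately show ?thesis using assms by blast
qed

text \<open>
  The minor with the rows of the minimal products and of \<open>w\<close>, and the columns of the monomials of
  \<open>J\<close> and of \<open>\<gamma>\<close>: multiplying on the left by the matrix of the reduction process makes it upper
  triangular, with the coefficient of \<open>\<gamma>\<close> in the reduction of \<open>w\<close> as the only diagonal entry
  different from 1.
\<close>

lemma NF_XF_in_ideal_A:
  assumes w: "snd w \<in> min_gens J"
  shows "lookup (NF (XF J w)) \<gamma> \<in> ideal_A J"
proof -
  define m where "m = mdeg (head w)"
  note I = ideal_ideal_A
  have span: "XF J w - NF (XF J w) \<in> XF_span (eks m)"
    by (rule NF_span) (use lookup_XF_in[OF w] keys_XF in \<open>auto simp: m_def\<close>)
  show ?thesis
  proof (cases "is_ek w \<or> lookup (NF (XF J w)) \<gamma> = 0")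
    case True
    then show ?thesis
    proof
      assume "is_ek w"
      then show ?thesis by (simp add: NF_XF ideal_on_zero[OF subring_kC I])
    qed (simp add: ideal_on_zero[OF subring_kC I])
  next
    case False
    \<comment> \<open>A nonzero coefficient forces \<gamma> to have degree m and to lie outside J;
      as \<open>w\<close> is not minimal either, the rows and the columns chosen below are
      distinct.\<close>
    then obtain b where b: "b \<in> keys (XF J w)" "\<gamma> \<in> keys (nf b)"
      unfolding lookup_lin_ext
      by (metis (mono_tags, lifting) in_keys_iff mult_zero_right sum.neutral)
    then have \<gamma>: "\<gamma> \<in> mons_out J" "mdeg \<gamma> = m"
      using keys_nf[of b] keys_XF[OF b(1)] by (auto simp: m_def)
    obtain bs where bs: "distinct bs" "set bs = ins m" "length bs = card (ins m)"
      by (rule obtain_ins_list)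
    define d where "d = card (ins m)"
    note bs = bs[folded d_def]
    have bs_in: "bs ! i \<in> mons_in J" "mdeg (bs ! i) = m" if "i < d" for i
      using that bs nth_mem[of i bs] by auto
    obtain t where t: "\<And>b. t b \<in> kC" "XF J w - NF (XF J w) = (\<Sum>b\<in>ins m. const (t b) * XF J (ek b))"
      using XF_span_coeffs[OF span] by blast
    have "\<forall>a. \<exists>t. (\<forall>b. t b \<in> kC) \<and> (a \<in> ins m \<longrightarrow>
        X_pow a - nf a = (\<Sum>b\<in>ins m. const (t b) * XF J (ek b)))"
    proof
      fix a
      show "\<exists>t. (\<forall>b. t b \<in> kC) \<and> (a \<in> ins m \<longrightarrow>
        X_pow a - nf a = (\<Sum>b\<in>ins m. const (t b) * XF J (ek b)))"
        using XF_span_coeffs[OF nf_span, of a] kC.zero_closed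
        by (cases "a \<in> ins m") (auto intro: exI[of _ "\<lambda>_. 0"])
    qed
    from choice[OF this] obtain s where s: "\<And>a b. s a b \<in> kC"
      "\<And>a. a \<in> ins m \<Longrightarrow> X_pow a - nf a = (\<Sum>b\<in>ins m. const (s a b) * XF J (ek b))"
      by blast
    define rs where "rs = map ek bs @ [w]"
    define cs where "cs = bs @ [\<gamma>]"
    define M where "M = mat (Suc d) (Suc d) (\<lambda>(i, j). lookup (XF J (rs ! i)) (cs ! j))"
    \<comment> \<open>Row i < d expresses X^b - \<open>nf b\<close> for b = \<open>bs ! i\<close> by
      the minimal rows; the last row subtracts from row \<open>w\<close> what its reduction
      removes.\<close>
    define E where "E = mat (Suc d) (Suc d) (\<lambda>(i, l).
      if i < d then (if l < d then s (bs ! i) (bs ! l) else 0)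
      else (if l < d then - t (bs ! l) else 1))"
    have car: "E \<in> carrier_mat (Suc d) (Suc d)" "M \<in> carrier_mat (Suc d) (Suc d)"
      by (auto simp: E_def M_def)
    have rs: "rs ! l = ek (bs ! l)" if "l < d" for l
      using that bs(3) by (simp add: rs_def nth_append)
    have rs_d: "rs ! d = w" using bs(3) by (simp add: rs_def nth_append)
    have cs: "cs ! l = bs ! l" if "l < d" for l
      using that bs(3) by (simp add: cs_def nth_append)
    have cs_d: "cs ! d = \<gamma>" using bs(3) by (simp add: cs_def nth_append)
    have EM: "(E * M) $$ (i, j)
        = lookup (if i < d then X_pow (bs ! i) - nf (bs ! i) else NF (XF J w)) (cs ! j)"
      if ij: "i < Suc d" "j < Suc d" for i j
    proof -
      have "(E * M) $$ (i, j) = (\<Sum>l = 0..<Suc d. E $$ (i, l) * M $$ (l, j))"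
        using ij by (simp add: E_def M_def scalar_prod_def)
      also have "\<dots> = (\<Sum>l = 0..<d. E $$ (i, l) * lookup (XF J (ek (bs ! l))) (cs ! j))
          + E $$ (i, d) * lookup (XF J w) (cs ! j)"
        using ij by (simp add: M_def rs rs_d)
      also have "\<dots> = lookup (if i < d then X_pow (bs ! i) - nf (bs ! i) else NF (XF J w)) (cs ! j)"
      proof (cases "i < d")
        case True
        then show ?thesis
          using lookup_XF_span_coeffs[OF s(2) bs, of "bs ! i"] bs_in[OF True] by (simp add: E_def)
      next
        case False
        then have "i = d" using ij by simp
        then show ?thesis
          using lookup_XF_span_coeffs[OF t(2) bs, of "cs ! j"]
          by (simp add: E_def sum_negf lookup_minus algebra_simps)
      qed
      finally show ?thesis .
    qed
    have triangle: "(E * M) $$ (i, j) = (if i = j then 1 else 0)"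
      if ij: "j \<le> i" "i < Suc d" "j < d" for i j
    proof -
      have j: "bs ! j \<notin> mons_out J" using bs_in[OF ij(3)] by (simp add: mons_out_iff)
      show ?thesis
      proof (cases "i < d")
        case True
        have "lookup (nf (bs ! i)) (bs ! j) = 0"
          using j keys_nf[of "bs ! i"] by (auto simp: in_keys_iff)
        then show ?thesis
          using EM[of i j] ij True cs bs
          by (simp add: lookup_minus lookup_X_pow nth_eq_iff_index_eq)
      next
        case False
        have "lookup (NF (XF J w)) (bs ! j) = 0"
          using j keys_NF[of "XF J w"] by (auto simp: in_keys_iff)
        then show ?thesis using EM[of i j] ij False cs by simp
      qed
    qed
    have "det (E * M) = prod_list (diag_mat (E * M))"
      by (rule det_upper_triangular[OF _ mult_carrier_mat[OF car]])
        (use car triangle in auto)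
    also have "\<dots> = (\<Prod>i = 0..<Suc d. (E * M) $$ (i, i))"
      using car by (simp add: prod_list_diag_prod del: prod.op_ivl_Suc)
    also have "\<dots> = (\<Prod>i = 0..<d. (E * M) $$ (i, i)) * lookup (NF (XF J w)) \<gamma>"
      using EM[of d d] cs_d by simp
    also have "(\<Prod>i = 0..<d. (E * M) $$ (i, i)) = 1"
      by (rule prod.neutral) (use triangle in auto)
    \<comment> \<open>The coefficient is a multiple of a minor in k[C]; the value of
      \<open>det E\<close> does not matter.\<close>
    finally have "lookup (NF (XF J w)) \<gamma> = det E * det M"
      using det_mult[OF car] by simp
    moreover have "det E \<in> kC"
      by (rule kC.det_closed[OF car(1)])
        (auto simp: E_def s(1) t(1) kC.uminus_closed kC.one_closed kC.zero_closed)
    moreover have "det M \<in> ideal_A J"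
      unfolding M_def
    proof (rule A_minor_in_ideal_A)
      have "inj_on ek (ins m)" by (rule inj_onI) (metis (mono_tags, lifting) head_ek mem_Collect_eq)
      moreover have "w \<noteq> ek b" if "b \<in> ins m" for b using is_ek_ek[of b] that False by auto
      ultimately show "distinct rs" using bs by (auto simp: rs_def distinct_map)
      show "distinct cs" using bs \<gamma> by (auto simp: cs_def mons_out_iff)
      show "length rs = Suc (card (ins m))" "length cs = Suc (card (ins m))"
        "Suc d = Suc (card (ins m))"
        using bs by (auto simp: rs_def cs_def d_def)
      show "set rs \<subseteq> A_rows J m"
        using bs w by (auto simp: rs_def A_rows_iff m_def snd_ek_in head_ek)
      show "set cs \<subseteq> {\<gamma>. mdeg \<gamma> = m}" using bs \<gamma> by (auto simp: cs_def)
    qed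
    ultimately show ?thesis using ideal_on_mult[OF subring_kC I] by simp
  qed
qed

text \<open>
  Modulo \<open>I\<close>, all the rows are combinations of the \<open>card (ins m)\<close> rows of the minimal products.
\<close>

lemma ideal_A_minimal:
  assumes I: "ideal I (ring_kC J)"
    and NF: "\<And>w g. snd w \<in> min_gens J \<Longrightarrow> lookup (NF (XF J w)) g \<in> I"
  shows "ideal_A J \<subseteq> I"
proof -
  note I' = I[unfolded ring_kC_eq]
  have "x \<in> I" if x: "x \<in> A_minors J m (Suc (card (ins m)))" for x m
  proof -
    define d where "d = card (ins m)"
    obtain rs cs where x: "x = det (mat (Suc d) (Suc d) (\<lambda>(i, j). lookup (XF J (rs ! i)) (cs ! j)))"
      "set rs \<subseteq> A_rows J m" "length rs = Suc d"
      using x by (auto simp: A_minors_def d_def)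
    have rows: "snd (rs ! i) \<in> min_gens J" "mdeg (head (rs ! i)) = m" if "i < Suc d" for i
      using subsetD[OF x(2) nth_mem[of i rs]] that x(3) unfolding A_rows_iff by auto
    obtain bs where bs: "distinct bs" "set bs = ins m" "length bs = d"
      unfolding d_def by (rule obtain_ins_list)
    have bs_in: "bs ! i \<in> mons_in J" if "i < d" for i
      using that bs nth_mem[of i bs] by auto
    have "\<forall>i. \<exists>t. (\<forall>b. t b \<in> kC) \<and> (i < Suc d \<longrightarrow>
        XF J (rs ! i) - NF (XF J (rs ! i)) = (\<Sum>b\<in>ins m. const (t b) * XF J (ek b)))"
      (is "\<forall>i. ?P i")
    proof
      fix i
      show "?P i"
      proof (cases "i < Suc d")
        case True
        have "XF J (rs ! i) - NF (XF J (rs ! i)) \<in> XF_span (eks m)"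
          by (rule NF_span) (use lookup_XF_in rows[OF True] keys_XF in auto)
        then show ?thesis using XF_span_coeffs by blast
      qed (auto intro: exI[of _ "\<lambda>_. 0"] kC.zero_closed)
    qed
    from choice[OF this] obtain t where t: "\<And>i b. t i b \<in> kC"
      "\<And>i. i < Suc d \<Longrightarrow> XF J (rs ! i) - NF (XF J (rs ! i)) = (\<Sum>b\<in>ins m. const (t i b) * XF J (ek b))"
      by blast
    \<comment> \<open>A product of a (d+1) x d and a d x (d+1) matrix, padded to square size: the
      last column of \<open>T\<close> and the last row of \<open>V\<close> are 0, so
      \<open>det V = 0\<close>.\<close>
    define T where "T = mat (Suc d) (Suc d) (\<lambda>(i, l). if l < d then t i (bs ! l) else 0)"
    define V where "V = mat (Suc d) (Suc d)
      (\<lambda>(l, j). if l < d then lookup (XF J (ek (bs ! l))) (cs ! j) else 0)"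
    define M where "M = mat (Suc d) (Suc d) (\<lambda>(i, j). lookup (XF J (rs ! i)) (cs ! j))"
    have car: "T \<in> carrier_mat (Suc d) (Suc d)" "V \<in> carrier_mat (Suc d) (Suc d)"
      "M \<in> carrier_mat (Suc d) (Suc d)"
      by (auto simp: T_def V_def M_def)
    have TV: "(T * V) $$ (i, j)
        = lookup (XF J (rs ! i)) (cs ! j) - lookup (NF (XF J (rs ! i))) (cs ! j)"
      if ij: "i < Suc d" "j < Suc d" for i j
    proof -
      have "(T * V) $$ (i, j) = (\<Sum>l = 0..<Suc d. T $$ (i, l) * V $$ (l, j))"
        using ij by (simp add: T_def V_def scalar_prod_def)
      also have "\<dots> = (\<Sum>l = 0..<d. t i (bs ! l) * lookup (XF J (ek (bs ! l))) (cs ! j))"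
        using ij by (simp add: T_def V_def)
      finally show ?thesis
        using lookup_XF_span_coeffs[OF t(2) bs, of i "cs ! j"] ij by (simp add: lookup_minus)
    qed
    have "det V = 0"
      unfolding det_def'[OF car(2)]
    proof (rule sum.neutral, intro ballI)
      fix p assume "p \<in> {p. p permutes {0..<Suc d}}"
      then have "p d < Suc d" using permutes_in_image[of p "{0..<Suc d}" d] by auto
      then have "V $$ (d, p d) = 0" by (simp add: V_def)
      then show "signof p * (\<Prod>i = 0..<Suc d. V $$ (i, p i)) = 0" by simp
    qed
    then have "det (T * V) = 0" by (simp add: det_mult[OF car(1,2)])
    \<comment> \<open>The entries of \<open>M\<close> and \<open>T * V\<close> differ by
      coefficients of normal forms, which lie in \<open>I\<close>.\<close>
    moreover have "det M - det (T * V) \<in> I"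
    proof (rule det_cong_mod_ideal[OF subring_kC I' car(3) mult_carrier_mat[OF car(1,2)]],
        intro conjI)
      fix i j assume ij: "i < Suc d" "j < Suc d"
      have "M $$ (i, j) = lookup (XF J (rs ! i)) (cs ! j)" using ij by (simp add: M_def)
      then show "M $$ (i, j) \<in> kC" "(T * V) $$ (i, j) \<in> kC" "M $$ (i, j) - (T * V) $$ (i, j) \<in> I"
        using TV[OF ij] NF[OF rows(1)[OF ij(1)]] lookup_XF_in[OF rows(1)[OF ij(1)]] lookup_NF_in
        by (auto intro!: kC.diff_closed)
    qed
    ultimately show "x \<in> I" by (simp add: x(1) M_def)
  qed
  then show ?thesis unfolding ideal_A_eq by (intro genideal_on_minimal[OF I']) blast
qed

section \<open>Equality of the three ideals\<close>

definition R_gens :: "('n cvar, 'k) mpol set" where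
  "R_gens = {lookup (NF (XF J w - XF J w')) \<gamma> | w w' \<gamma>. (w, w') \<in> S_pairs J}"

definition R'_gens :: "('n cvar, 'k) mpol set" where
  "R'_gens = {lookup (NF (XF J w - XF J w')) \<gamma> | w w' \<gamma>.
     (w, w') \<in> S_pairs J \<and> w \<in> V_set J (mdeg (head w))}"

text \<open>Proved as a cycle: R' is contained in R by its generators, R in A because
  \<open>NF\<close> is linear, and A in R' by the induction on cofactors.\<close>

lemma ideals_eq: "ideal_A J = ideal_R J \<and> ideal_R J = ideal_R' J"
proof -
  have R: "ideal_R J = Idl\<^bsub>ring_on kC\<^esub> R_gens" "ideal_R' J = Idl\<^bsub>ring_on kC\<^esub> R'_gens"
    by (simp_all add: ideal_R_def ideal_R'_def R_gens_def R'_gens_def complete_red_eq ring_kC_eq)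
  have sub: "R_gens \<subseteq> kC"
    by (auto simp: R_gens_def S_pairs_def lookup_minus
        intro!: lookup_NF_in kC.diff_closed lookup_XF_in)
  have sub': "R'_gens \<subseteq> R_gens" unfolding R_gens_def R'_gens_def by blast
  have "ideal_R' J \<subseteq> ideal_R J"
    unfolding R
    by (rule genideal_on_minimal[OF ideal_genideal_on[OF subring_kC sub]])
      (use sub' genideal_on_self[OF subring_kC sub] in blast)
  moreover have "ideal_R J \<subseteq> ideal_A J"
    unfolding R(1)
    by (rule genideal_on_minimal[OF ideal_ideal_A])
      (auto simp: R_gens_def S_pairs_def lin_ext_diff lookup_minus
        intro!: ideal_on_diff[OF subring_kC ideal_ideal_A] NF_XF_in_ideal_A)
  moreover have "ideal_A J \<subseteq> ideal_R' J"
  proof -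
    have sub'': "R'_gens \<subseteq> kC" using sub sub' by blast
    have I: "ideal (ideal_R' J) (ring_kC J)"
      unfolding R ring_kC_eq by (rule ideal_genideal_on[OF subring_kC sub''])
    show ?thesis
    proof (rule ideal_A_minimal[OF I], rule NF_XF_in_ideal[OF I])
      fix v w g assume "(v, w) \<in> S_pairs J" "v \<in> V_set J (mdeg (head v))"
      then have "lookup (NF (XF J v - XF J w)) g \<in> R'_gens" unfolding R'_gens_def by blast
      then show "lookup (NF (XF J v - XF J w)) g \<in> ideal_R' J"
        using genideal_on_self[OF subring_kC sub''] R(2) by blast
    qed
  qed
  ultimately show ?thesis by blast
qed

section \<open>Homogeneity of the stratum\<close>

text \<open>The entry in row \<open>w\<close> and column \<open>g\<close> of A_m has weight head
  minus column, the shape that \<open>C_hom_det\<close> asks for.\<close>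

lemma C_hom_XF:
  "C_hom (lookup (XF J w) g) (\<lambda>i. int (lookup (head w) i) - int (lookup g i))" (is "C_hom _ ?w")
proof -
  have "C_hom (lookup (X_pow (head w)) g :: ('n cvar, 'k) mpol) ?w"
    by (simp add: lookup_X_pow C_hom_one)
  moreover have "C_hom (C_var (snd w) \<gamma> * lookup (X_pow (fst w + \<gamma>)) g :: ('n cvar, 'k) mpol) ?w"
    for \<gamma>
  proof (cases "fst w + \<gamma> = g")
    case True
    then show ?thesis
      using C_hom_C_var[of "snd w" \<gamma>] by (auto simp: lookup_X_pow head_def lookup_add)
  qed (simp add: lookup_X_pow)
  ultimately show ?thesis
    unfolding XF_eq tail_eq lookup_minus lookup_sum lookup_const_mult
      diff_conv_add_uminus[of "lookup _ _"]
    by (intro C_hom_add C_hom_uminus C_hom_sum)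
qed

lemma ideal_A_homogeneous: "w_homogeneous C_weight (ideal_A J)"
  unfolding ideal_A_eq
proof (rule w_homogeneous_genideal[OF subring_kC])
  show "(\<Union>m. A_minors J m (Suc (card (ins m)))) \<subseteq> kC" using A_minors_subset by blast
  show "Poly_Mapping.single m (lookup s m) \<in> kC" if "s \<in> kC" for s m
    using that by (auto simp: kC_def in_keys_iff)
  show "C_weight (m + a) = C_weight (m + b) \<longleftrightarrow> C_weight a = C_weight b" for m a b :: "'n cvar mon"
    by (rule C_weight_cancel)
  fix f assume "f \<in> (\<Union>m. A_minors J m (Suc (card (ins m))))"
  then obtain r rs cs where f: "f = det (mat r r (\<lambda>(i, j). lookup (XF J (rs ! i)) (cs ! j)))"
    unfolding A_minors_def by blast
  have "C_hom f (\<lambda>x. (\<Sum>i = 0..<r. int (lookup (head (rs ! i)) x))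
      - (\<Sum>i = 0..<r. int (lookup (cs ! i) x)))"
    unfolding f by (rule C_hom_det) (auto intro: C_hom_XF)
  then show "\<exists>h. \<forall>m\<in>keys f. C_weight m = h" unfolding C_hom_def by blast
qed

section \<open>Points of the stratum\<close>

abbreviation NF_at :: "('n cvar \<Rightarrow> 'k) \<Rightarrow> ('n, 'k) mpol \<Rightarrow> ('n, 'k) mpol" where
  "NF_at c \<equiv> lin_ext (\<lambda>b. specialize c (nf b))"

lemma keys_specialize: "keys (specialize c h) \<subseteq> keys h"
  by (auto simp: in_keys_iff)

lemma NF_at_specialize: "NF_at c (specialize c h) = specialize c (NF h)"
  using lin_ext_superset[OF finite_keys keys_specialize, of "\<lambda>b. specialize c (nf b)" c h]
  by (simp add: lin_ext_def specialize_sum specialize_const_mult)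

lemma keys_NF_at: "keys (NF_at c f) \<subseteq> mons_out J"
proof
  fix g assume "g \<in> keys (NF_at c f)"
  then have "(\<Sum>m\<in>keys f. lookup f m * eval_at c (lookup (nf m) g)) \<noteq> 0"
    by (simp add: in_keys_iff lookup_lin_ext)
  then obtain m where "lookup f m * eval_at c (lookup (nf m) g) \<noteq> 0" by (meson sum.neutral)
  then have "g \<in> keys (nf m)" by (auto simp: in_keys_iff)
  then show "g \<in> mons_out J" using keys_nf by blast
qed

lemma NF_at_id:
  assumes f: "keys f \<subseteq> mons_out J"
  shows "NF_at c f = f"
proof -
  have "NF_at c f = (\<Sum>m\<in>keys f. Poly_Mapping.single m (lookup f m))"
    unfolding lin_ext_def by (rule sum.cong) (use f in \<open>auto simp: nf_out const_mult_X_pow\<close>)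
  then show ?thesis by (simp flip: sum_singles)
qed

lemma F_poly_eq_XF: "F_poly J \<alpha> = XF J (0, \<alpha>)"
  by (simp add: XF_def)

lemma lookup_specialize_F:
  "lookup (specialize c (F_poly J \<alpha>)) g
     = (if g = \<alpha> then 1 else 0) - (if g \<in> outs (mdeg \<alpha>) then c (\<alpha>, g) else 0)"
proof -
  have "eval_at c (lookup (tail J (0, \<alpha>)) g)
      = (\<Sum>\<gamma>\<in>outs (mdeg \<alpha>). if \<gamma> = g then c (\<alpha>, \<gamma>) else 0)"
    unfolding tail_eq lookup_sum eval_at_sum
    by (rule sum.cong) (auto simp: lookup_X_pow)
  also have "\<dots> = (if g \<in> outs (mdeg \<alpha>) then c (\<alpha>, g) else 0)" by simp
  finally show ?thesis
    by (simp add: F_poly_eq_XF XF_eq lookup_minus eval_at_diff head_def lookup_X_pow)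
qed

lemma XF_span_specialize:
  assumes I: "ideal I ring_P" and F: "\<And>\<alpha>. \<alpha> \<in> min_gens J \<Longrightarrow> specialize c (F_poly J \<alpha>) \<in> I"
    and h: "h \<in> XF_span Q" and Q: "\<And>w. w \<in> Q \<Longrightarrow> snd w \<in> min_gens J"
  shows "specialize c h \<in> I"
  using h
proof (induction h rule: XF_span.induct)
  case zero
  then show ?case by (simp add: ideal_on_zero[OF subring_set_UNIV I])
next
  case (step h t w)
  then show ?case
    using F[OF Q[of w]]
    by (simp add: specialize_add specialize_const_mult XF_def specialize_X_pow_mult
        ideal_on_add[OF subring_set_UNIV I] ideal_on_mult[OF subring_set_UNIV I])
qed

text \<open>Specialize the combination in \<open>nf_span\<close>. The ideal is left arbitrary
  because both \<open>ideal_at J c\<close> and a given \<open>I\<close> are needed.\<close>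

lemma minus_NF_at_in_ideal:
  assumes I: "ideal I ring_P" and F: "\<And>\<alpha>. \<alpha> \<in> min_gens J \<Longrightarrow> specialize c (F_poly J \<alpha>) \<in> I"
  shows "f - NF_at c f \<in> I"
proof -
  have "f - NF_at c f = (\<Sum>m\<in>keys f. const (lookup f m) * specialize c (X_pow m - nf m))"
    by (subst (1) sum_singles[of f])
      (simp add: lin_ext_def right_diff_distrib sum_subtractf const_mult_X_pow specialize_diff)
  also have "\<dots> \<in> I"
    by (intro ideal_on_sum[OF subring_set_UNIV I] ideal_on_mult[OF subring_set_UNIV I] UNIV_I
        XF_span_specialize[OF I F nf_span]) (auto simp: is_ek_def)
  finally show ?thesis .
qed

text \<open>
  If the monomials outside \<open>J\<close> are independent modulo an ideal \<open>I\<close> containing the specialization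
  of all the \<open>F\<^sub>\<alpha>\<close>, then the completely reduced products, which lie in \<open>I\<close>, must vanish.
\<close>

lemma NF_XF_vanish:
  assumes I: "ideal I ring_P" and F: "\<And>\<alpha>. \<alpha> \<in> min_gens J \<Longrightarrow> specialize c (F_poly J \<alpha>) \<in> I"
    and indep: "\<And>p. keys p \<subseteq> mons_out J \<Longrightarrow> p \<in> I \<Longrightarrow> p = 0"
    and w: "snd w \<in> min_gens J"
  shows "eval_at c (lookup (NF (XF J w)) g) = 0"
proof -
  have XF: "specialize c (XF J w) \<in> I"
    using F[OF w] by (simp add: XF_def specialize_X_pow_mult ideal_on_mult[OF subring_set_UNIV I])
  have "specialize c (XF J w) - specialize c (NF (XF J w)) \<in> I"
    using minus_NF_at_in_ideal[OF I F, of "specialize c (XF J w)"] by (simp add: NF_at_specialize)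
  from ideal_on_diff[OF subring_set_UNIV I XF this]
  have "specialize c (NF (XF J w)) \<in> I" by simp
  moreover have "keys (specialize c (NF (XF J w))) \<subseteq> mons_out J"
    using keys_specialize keys_NF by blast
  ultimately have "specialize c (NF (XF J w)) = 0" by (rule indep[rotated])
  then have "lookup (specialize c (NF (XF J w))) g = 0" by simp
  then show ?thesis by simp
qed

text \<open>The elements of k[C] vanishing at \<open>c\<close> form an ideal. If it contains the
  coefficients of all normal forms, it contains \<open>ideal_A J\<close> by
  \<open>ideal_A_minimal\<close>; the converse is \<open>NF_XF_in_ideal_A\<close>.\<close>

lemma stratum_points_iff:
  "c \<in> stratum_points J \<longleftrightarrow> c \<in> C_vars J \<rightarrow>\<^sub>E UNIV \<and>
     (\<forall>w g. snd w \<in> min_gens J \<longrightarrow> eval_at c (lookup (NF (XF J w)) g) = 0)"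
proof (intro iffI conjI allI impI)
  assume "c \<in> stratum_points J"
  then show "c \<in> C_vars J \<rightarrow>\<^sub>E UNIV"
    "snd w \<in> min_gens J \<Longrightarrow> eval_at c (lookup (NF (XF J w)) g) = 0" for w g
    using NF_XF_in_ideal_A[of w g] by (auto simp: stratum_points_def)
next
  assume c: "c \<in> C_vars J \<rightarrow>\<^sub>E UNIV \<and>
     (\<forall>w g. snd w \<in> min_gens J \<longrightarrow> eval_at c (lookup (NF (XF J w)) g) = 0)"
  let ?I = "{p \<in> kC. eval_at c p = 0}"
  have "ideal ?I (ring_kC J)"
    unfolding ring_kC_eq kC.ideal_ring_on_iff
    by (auto simp: kC.zero_closed kC.add_closed kC.mult_closed eval_at_add eval_at_mult)
  then have "ideal_A J \<subseteq> ?I"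
    by (rule ideal_A_minimal) (use c lookup_XF_in lookup_NF_in in auto)
  then show "c \<in> stratum_points J" using c by (auto simp: stratum_points_def)
qed

section \<open>The ideal belonging to a point\<close>

lemma ideal_ideal_at: "ideal (ideal_at J c) ring_P"
  unfolding ideal_at_def by (rule ideal_genideal_on[OF subring_set_UNIV]) simp

lemma F_in_ideal_at: "\<alpha> \<in> min_gens J \<Longrightarrow> specialize c (F_poly J \<alpha>) \<in> ideal_at J c"
  unfolding ideal_at_def
  by (rule subsetD[OF genideal_on_self[OF subring_set_UNIV subset_UNIV]]) (rule imageI)

lemma ideal_at_minimal:
  assumes "ideal I ring_P" "\<And>\<alpha>. \<alpha> \<in> min_gens J \<Longrightarrow> specialize c (F_poly J \<alpha>) \<in> I"
  shows "ideal_at J c \<subseteq> I"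
  unfolding ideal_at_def using assms by (intro genideal_on_minimal) auto

lemma ideal_at_homogeneous: "w_homogeneous mdeg (ideal_at J c)"
  unfolding ideal_at_def
proof (rule w_homogeneous_genideal[OF subring_set_UNIV])
  fix f assume "f \<in> (\<lambda>\<alpha>. specialize c (F_poly J \<alpha>)) ` min_gens J"
  then obtain \<alpha> where "f = specialize c (F_poly J \<alpha>)" by blast
  then have "\<forall>m\<in>keys f. mdeg m = mdeg \<alpha>"
    using keys_specialize keys_XF[of _ "(0, \<alpha>)"] by (fastforce simp: F_poly_eq_XF head_def)
  then show "\<exists>h. \<forall>m\<in>keys f. mdeg m = h" by blast
qed auto

text \<open>The kernel of \<open>NF_at c\<close> is a priori only a subspace. Quantifying over all
  multipliers \<open>g\<close> gives the largest ideal inside it, which contains the specialized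
  generators because every X^\<delta> F_\<alpha> reduces to 0 at \<open>c\<close>.\<close>

lemma ideal_at_independent:
  assumes c: "c \<in> stratum_points J" and p: "keys p \<subseteq> mons_out J" "p \<in> ideal_at J c"
  shows "p = 0"
proof -
  let ?K = "{f. \<forall>g. NF_at c (g * f) = 0}"
  have "ideal ?K ring_P"
    unfolding subring_set.ideal_ring_on_iff[OF subring_set_UNIV]
    by (auto simp: distrib_left lin_ext_add mult.assoc[symmetric])
  moreover have "specialize c (F_poly J \<alpha>) \<in> ?K" if \<alpha>: "\<alpha> \<in> min_gens J" for \<alpha>
  proof -
    have "NF_at c (g * specialize c (F_poly J \<alpha>)) = 0" for g
    proof (induction g rule: mpol_induct)
      case (single m a)
      have "NF_at c (X_pow m * specialize c (F_poly J \<alpha>)) = specialize c (NF (XF J (m, \<alpha>)))"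
        by (simp add: NF_at_specialize[symmetric] XF_def specialize_X_pow_mult)
      also have "\<dots> = 0"
        by (rule poly_mapping_eqI) (use c \<alpha> in \<open>simp add: stratum_points_iff\<close>)
      finally show ?case
        by (simp add: const_mult_X_pow[symmetric] mult.assoc lin_ext_const_mult)
    qed (simp_all add: distrib_right lin_ext_add)
    then show ?thesis by simp
  qed
  ultimately have "p \<in> ?K" using ideal_at_minimal p(2) by blast
  then have "NF_at c (1 * p) = 0" by blast
  then show "p = 0" using NF_at_id[OF p(1)] by simp
qed

lemma basis_of_quotient_ideal_at:
  assumes "c \<in> stratum_points J"
  shows "basis_of_quotient (mons_out J) (ideal_at J c)"
  unfolding basis_of_quotient_def
  using ideal_at_independent[OF assms] keys_NF_at
    minus_NF_at_in_ideal[OF ideal_ideal_at F_in_ideal_at]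
  by (metis lookup_zero)

text \<open>The difference of two specializations of F_\<alpha> lies in the common ideal and is
  supported outside J, so it is 0; its coefficients are the differences of the coordinates.\<close>

lemma inj_ideal_at: "inj_on (ideal_at J) (stratum_points J)"
proof (rule inj_onI)
  fix c c' assume c: "c \<in> stratum_points J" "c' \<in> stratum_points J" "ideal_at J c = ideal_at J c'"
  have "c (\<alpha>, \<gamma>) = c' (\<alpha>, \<gamma>)" if "(\<alpha>, \<gamma>) \<in> C_vars J" for \<alpha> \<gamma>
  proof -
    from that have \<alpha>: "\<alpha> \<in> min_gens J" "\<gamma> \<in> outs (mdeg \<alpha>)" by (auto simp: C_vars_def)
    define p where "p = specialize c (F_poly J \<alpha>) - specialize c' (F_poly J \<alpha>)"
    have lookup: "lookup p g = (if g \<in> outs (mdeg \<alpha>) then c' (\<alpha>, g) - c (\<alpha>, g) else 0)" for g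
      unfolding p_def lookup_minus lookup_specialize_F by auto
    have "p \<in> ideal_at J c"
      unfolding p_def using F_in_ideal_at[OF \<alpha>(1)] c(3)
      by (intro ideal_on_diff[OF subring_set_UNIV ideal_ideal_at]) auto
    moreover have "keys p \<subseteq> mons_out J" by (auto simp: in_keys_iff lookup split: if_splits)
    ultimately have "p = 0" using ideal_at_independent[OF c(1)] by blast
    then show ?thesis using lookup[of \<gamma>] \<alpha>(2) by simp
  qed
  then show "c = c'"
    using c(1,2) by (intro PiE_ext[of c "C_vars J" "\<lambda>_. UNIV"]) (auto simp: stratum_points_def)
qed

lemma surj_ideal_at:
  assumes I: "ideal I ring_P" and hom: "w_homogeneous mdeg I"
    and basis: "basis_of_quotient (mons_out J) I"
  shows "\<exists>c\<in>stratum_points J. ideal_at J c = I"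
proof -
  have indep: "p = 0" if "keys p \<subseteq> mons_out J" "p \<in> I" for p
    using basis that by (intro poly_mapping_eqI) (auto simp: basis_of_quotient_def)
  have "\<forall>\<alpha>. \<exists>p. keys p \<subseteq> mons_out J \<and> X_pow \<alpha> - p \<in> I"
    using basis by (simp add: basis_of_quotient_def)
  from choice[OF this] obtain p where p: "\<And>\<alpha>. keys (p \<alpha>) \<subseteq> mons_out J" "\<And>\<alpha>. X_pow \<alpha> - p \<alpha> \<in> I"
    by blast
  \<comment> \<open>The coordinates are the coefficients of a representative of X^\<alpha> modulo
    \<open>I\<close>.\<close>
  define c where "c = (\<lambda>v\<in>C_vars J. lookup (p (fst v)) (snd v))"
  have F: "specialize c (F_poly J \<alpha>) \<in> I" if \<alpha>: "\<alpha> \<in> min_gens J" for \<alpha>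
  proof -
    \<comment> \<open>The representative need not be homogeneous; since \<open>I\<close> is, its
      component of degree |\<alpha>| can be used instead.\<close>
    have "specialize c (F_poly J \<alpha>) = w_component mdeg (mdeg \<alpha>) (X_pow \<alpha> - p \<alpha>)"
    proof (rule poly_mapping_eqI)
      fix g
      have "c (\<alpha>, g) = lookup (p \<alpha>) g" if "g \<in> outs (mdeg \<alpha>)"
        using that \<alpha> by (simp add: c_def C_vars_def)
      moreover have "lookup (p \<alpha>) g = 0" if "g \<notin> mons_out J"
        using that p(1)[of \<alpha>] by (auto simp: in_keys_iff)
      ultimately show "lookup (specialize c (F_poly J \<alpha>)) g
          = lookup (w_component mdeg (mdeg \<alpha>) (X_pow \<alpha> - p \<alpha>)) g"
        unfolding lookup_specialize_F lookup_w_component lookup_minus lookup_X_pow by auto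
    qed
    then show ?thesis using hom p(2)[of \<alpha>] by (simp add: w_homogeneous_def)
  qed
  have "c \<in> stratum_points J"
    unfolding stratum_points_iff using NF_XF_vanish[OF I F indep] by (simp add: c_def)
  moreover have sub: "ideal_at J c \<subseteq> I" by (rule ideal_at_minimal[OF I F])
  moreover have "I \<subseteq> ideal_at J c"
  proof
    fix f assume f: "f \<in> I"
    have d: "f - NF_at c f \<in> ideal_at J c"
      by (rule minus_NF_at_in_ideal[OF ideal_ideal_at F_in_ideal_at])
    \<comment> \<open>The reduced form of \<open>f\<close> lies in \<open>I\<close> and is supported
      outside J, so independence makes it 0.\<close>
    then have "f - (f - NF_at c f) \<in> I" using ideal_on_diff[OF subring_set_UNIV I f] sub by blast
    then have "NF_at c f = 0" using indep[OF keys_NF_at] by simp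
    then show "f \<in> ideal_at J c" using d by simp
  qed
  ultimately show ?thesis by blast
qed

lemma bij_ideal_at:
  "bij_betw (ideal_at J) (stratum_points J)
     {I. ideal I ring_P \<and> w_homogeneous mdeg I \<and> basis_of_quotient (mons_out J) I}"
  unfolding bij_betw_def
  using inj_ideal_at surj_ideal_at ideal_ideal_at ideal_at_homogeneous basis_of_quotient_ideal_at
  by (fastforce simp: image_iff set_eq_iff)

lemma specialize_origin: "specialize (origin J) (F_poly J \<alpha>) = X_pow \<alpha>" if "\<alpha> \<in> min_gens J"
proof (rule poly_mapping_eqI)
  fix g
  have "origin J (\<alpha>, g) = 0" if "g \<in> outs (mdeg \<alpha>)"
    using that \<open>\<alpha> \<in> min_gens J\<close> by (simp add: origin_def C_vars_def)
  then show "lookup (specialize (origin J) (F_poly J \<alpha>)) g = lookup (X_pow \<alpha>) g"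
    unfolding lookup_specialize_F lookup_X_pow by auto
qed

lemma ideal_at_origin: "ideal_at J (origin J) = J"
proof
  show "ideal_at J (origin J) \<subseteq> J"
    by (rule ideal_at_minimal[OF ideal_J])
      (use min_gens_in in \<open>simp add: specialize_origin mons_in_def\<close>)
  show "J \<subseteq> ideal_at J (origin J)"
  proof
    note I = ideal_ideal_at[of "origin J"]
    fix f assume "f \<in> J"
    then have f: "keys f \<subseteq> mons_in J" by (simp add: in_J_iff)
    have "X_pow b \<in> ideal_at J (origin J)" if "b \<in> mons_in J" for b
    proof -
      have "X_pow b = X_pow (fst (ek b)) * (X_pow (snd (ek b)) :: ('n, 'k) mpol)"
        using head_ek[OF that] by (simp add: head_def flip: X_pow_add)
      then show ?thesis
        using F_in_ideal_at[OF snd_ek_in[OF that], of "origin J"]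
        by (simp add: specialize_origin snd_ek_in[OF that] ideal_on_mult[OF subring_set_UNIV I])
    qed
    then have "(\<Sum>b\<in>keys f. const (lookup f b) * X_pow b) \<in> ideal_at J (origin J)"
      using f
      by (intro ideal_on_sum[OF subring_set_UNIV I] ideal_on_mult[OF subring_set_UNIV I]) auto
    then show "f \<in> ideal_at J (origin J)" by (simp add: const_mult_X_pow flip: sum_singles)
  qed
qed

text \<open>Instance of \<open>NF_XF_vanish\<close> with J itself as the ideal: it contains every
  X^\<alpha>, and only 0 is both in J and supported outside it.\<close>

lemma origin_in_stratum: "origin J \<in> stratum_points J"
proof -
  have "p = 0" if "keys p \<subseteq> mons_out J" "p \<in> J" for p
  proof (rule poly_mapping_eqI)
    fix g
    have "g \<notin> keys p" using that in_J_iff[of p] mons_out_iff[of g] by blast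
    then show "lookup p g = lookup 0 g" by (simp add: in_keys_iff)
  qed
  then have "eval_at (origin J) (lookup (NF (XF J w)) g) = 0" if "snd w \<in> min_gens J" for w g
    using that min_gens_in
    by (intro NF_XF_vanish[OF ideal_J]) (auto simp: specialize_origin mons_in_def)
  then show ?thesis by (simp add: stratum_points_iff origin_def)
qed

end

theorem theorem22:
  fixes J :: "('n::{finite,linorder}, 'k::alg_closed_field) mpol set"
  assumes "monomial_ideal J" and "strongly_stable J"
  shows "(bij_betw (ideal_at J) (stratum_points J)
            {I. ideal I ring_P \<and> w_homogeneous mdeg I \<and> basis_of_quotient (mons_out J) I} \<and>
          origin J \<in> stratum_points J \<and> ideal_at J (origin J) = J) \<and>
         w_homogeneous C_weight (ideal_A J) \<and>
         (ideal_A J = ideal_R J \<and> ideal_R J = ideal_R' J)"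
proof -
  interpret stable_ideal J by unfold_locales fact+
  show ?thesis
    using bij_ideal_at origin_in_stratum ideal_at_origin ideal_A_homogeneous ideals_eq by blast
qed

end
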